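(* Let $\mathcal{C}$ be a finite connected category. The set of prime ideals of the ring $B^S(\mathcal{C})$ is $$\operatorname{Spec}(B^S(\mathcal{C}))=\{\mathfrak{p}_S,\ \mathfrak{p}_{S,p}\mid S \text{ a simple } \mathcal{C}\text{-set},\ p \text{ a prime number}\},$$ where $\mathfrak{p}_S=\ker(\varphi_S)$ and $\mathfrak{p}_{S,p}=\ker(\pi_p\circ\varphi_S)$, with $\varphi_S\colon B^S(\mathcal{C})\to\mathbb{Z}$ the mark of $S$ and $\pi_p\colon\mathbb{Z}\to\mathbb{Z}/p\mathbb{Z}$ the canonical projection.
   Context: For a finite category $\mathcal{C}$ with object set $\mathcal{C}_0$, a $\mathcal{C}$-set is a covariant functor $\Omega$ from $\mathcal{C}$ to the category of finite sets; morphisms of $\mathcal{C}$-sets are natural transformations, and $\operatorname{Hom}_{\mathcal{C}\text{-set}}(\Omega,\Psi)$ denotes the set of them; a $\mathcal{C}$-subset is a subfunctor. Disjoint unions and products of $\mathcal{C}$-sets are formed objectwise. A $\mathcal{C}$-set is simple if it is non-empty and its only $\mathcal{C}$-subsets are itself and the empty $\mathcal{C}$-set (sending every object to $\emptyset$). The socle $\operatorname{soc}(\Omega)$ is the union of all simple $\mathcal{C}$-subsets of $\Omega$ (this union is disjoint). $1_{\mathcal{C}}$ is the $\mathcal{C}$-set sending every object to a one-point set. The simple Burnside ring $B^S(\mathcal{C})$ is the Grothendieck group, with respect to disjoint union, of isomorphism classes of finite disjoint unions of simple $\mathcal{C}$-sets (equivalently, the free abelian group on isomorphism classes of simple $\mathcal{C}$-sets),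 with the bilinear product determined by $[S]\star[T]=[\operatorname{soc}(S\times T)]$ and identity element $[\operatorname{soc}(1_{\mathcal{C}})]$. For a simple $\mathcal{C}$-set $S$, the mark of $S$ is the ring homomorphism $\varphi_S\colon B^S(\mathcal{C})\to\mathbb{Z}$ determined by $[\Omega]\mapsto|\operatorname{Hom}_{\mathcal{C}\text{-set}}(S,\Omega)|$. *)

theory Defs
  imports
    "HOL-Library.FuncSet"
    "HOL-Library.Poly_Mapping"
    "HOL-Computational_Algebra.Primes"
    "HOL-Algebra.Free_Abelian_Groups"
    "HOL-Algebra.IntRing"
begin

section \<open>Finite categories\<close>

record ('o, 'm) cat =
  Obj :: "'o set"
  Mor :: "'m set"
  Dom :: "'m \<Rightarrow> 'o"
  Cod :: "'m \<Rightarrow> 'o"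
  Ide :: "'o \<Rightarrow> 'm"
  Cmp :: "'m \<Rightarrow> 'm \<Rightarrow> 'm"  \<comment> \<open>\<open>Cmp C g f\<close> is \<open>g\<close> after \<open>f\<close>\<close>

locale finite_category =
  fixes C :: "('o, 'm) cat"
  assumes finite_Obj: "finite (Obj C)"
    and finite_Mor: "finite (Mor C)"
    and Dom_in: "f \<in> Mor C \<Longrightarrow> Dom C f \<in> Obj C"
    and Cod_in: "f \<in> Mor C \<Longrightarrow> Cod C f \<in> Obj C"
    and Ide_in: "x \<in> Obj C \<Longrightarrow> Ide C x \<in> Mor C"
    and Dom_Ide: "x \<in> Obj C \<Longrightarrow> Dom C (Ide C x) = x"
    and Cod_Ide: "x \<in> Obj C \<Longrightarrow> Cod C (Ide C x) = x"
    and Cmp_in: "\<lbrakk>f \<in> Mor C; g \<in> Mor C; Cod C f = Dom C g\<rbrakk> \<Longrightarrow> Cmp C g f \<in> Mor C"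
    and Dom_Cmp: "\<lbrakk>f \<in> Mor C; g \<in> Mor C; Cod C f = Dom C g\<rbrakk> \<Longrightarrow> Dom C (Cmp C g f) = Dom C f"
    and Cod_Cmp: "\<lbrakk>f \<in> Mor C; g \<in> Mor C; Cod C f = Dom C g\<rbrakk> \<Longrightarrow> Cod C (Cmp C g f) = Cod C g"
    and Cmp_Ide: "f \<in> Mor C \<Longrightarrow> Cmp C f (Ide C (Dom C f)) = f"
    and Ide_Cmp: "f \<in> Mor C \<Longrightarrow> Cmp C (Ide C (Cod C f)) f = f"
    and Cmp_assoc: "\<lbrakk>f \<in> Mor C; g \<in> Mor C; h \<in> Mor C; Cod C f = Dom C g; Cod C g = Dom C h\<rbrakk>
      \<Longrightarrow> Cmp C h (Cmp C g f) = Cmp C (Cmp C h g) f"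

text \<open>Non-empty, and any two objects are joined by a zigzag of morphisms.\<close>

definition connected_category :: "('o, 'm) cat \<Rightarrow> bool" where
  "connected_category C \<longleftrightarrow> Obj C \<noteq> {} \<and>
    (\<forall>x\<in>Obj C. \<forall>y\<in>Obj C.
      (x, y) \<in> ({(Dom C f, Cod C f) |f. f \<in> Mor C} \<union> {(Cod C f, Dom C f) |f. f \<in> Mor C})\<^sup>*)"

section \<open>\<open>\<C>\<close>-sets\<close>

text \<open>
  All maps are extensional (\<open>undefined\<close> outside the objects, the morphisms and the sets in
  question), so that HOL equality is equality of functors and of natural transformations; in
  particular a \<open>\<C>\<close>-set has only finitely many \<open>\<C>\<close>-subsets, and there are only finitely many
  natural transformations between two \<open>\<C>\<close>-sets.
\<close>

record ('o, 'm, 'x) cset =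
  obj :: "'o \<Rightarrow> 'x set"
  act :: "'m \<Rightarrow> 'x \<Rightarrow> 'x"

definition is_cset :: "('o, 'm) cat \<Rightarrow> ('o, 'm, 'x) cset \<Rightarrow> bool" where
  "is_cset C \<Omega> \<longleftrightarrow>
    obj \<Omega> \<in> Obj C \<rightarrow>\<^sub>E {X. finite X} \<and>
    act \<Omega> \<in> (\<Pi>\<^sub>E f\<in>Mor C. obj \<Omega> (Dom C f) \<rightarrow>\<^sub>E obj \<Omega> (Cod C f)) \<and>
    (\<forall>x\<in>Obj C. \<forall>a\<in>obj \<Omega> x. act \<Omega> (Ide C x) a = a) \<and>
    (\<forall>f\<in>Mor C. \<forall>g\<in>Mor C. Cod C f = Dom C g \<longrightarrow>
      (\<forall>a\<in>obj \<Omega> (Dom C f). act \<Omega> (Cmp C g f) a = act \<Omega> g (act \<Omega> f a)))"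

definition Hom :: "('o, 'm) cat \<Rightarrow> ('o, 'm, 'x) cset \<Rightarrow> ('o, 'm, 'y) cset \<Rightarrow> ('o \<Rightarrow> 'x \<Rightarrow> 'y) set"
  where
  "Hom C \<Omega> \<Psi> = {\<eta> \<in> (\<Pi>\<^sub>E x\<in>Obj C. obj \<Omega> x \<rightarrow>\<^sub>E obj \<Psi> x).
    \<forall>f\<in>Mor C. \<forall>a\<in>obj \<Omega> (Dom C f). \<eta> (Cod C f) (act \<Omega> f a) = act \<Psi> f (\<eta> (Dom C f) a)}"

definition cset_iso :: "('o, 'm) cat \<Rightarrow> ('o, 'm, 'x) cset \<Rightarrow> ('o, 'm, 'y) cset \<Rightarrow> bool" where
  "cset_iso C \<Omega> \<Psi> \<longleftrightarrow> (\<exists>\<eta>\<in>Hom C \<Omega> \<Psi>. \<exists>\<theta>\<in>Hom C \<Psi> \<Omega>. \<forall>x\<in>Obj C.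
    (\<forall>a\<in>obj \<Omega> x. \<theta> x (\<eta> x a) = a) \<and> (\<forall>b\<in>obj \<Psi> x. \<eta> x (\<theta> x b) = b))"

definition csubset :: "('o, 'm) cat \<Rightarrow> ('o, 'm, 'x) cset \<Rightarrow> ('o, 'm, 'x) cset \<Rightarrow> bool" where
  "csubset C \<Phi> \<Omega> \<longleftrightarrow> is_cset C \<Phi> \<and>
    (\<forall>x\<in>Obj C. obj \<Phi> x \<subseteq> obj \<Omega> x) \<and>
    (\<forall>f\<in>Mor C. \<forall>a\<in>obj \<Phi> (Dom C f). act \<Phi> f a = act \<Omega> f a)"

definition empty_cset :: "('o, 'm) cat \<Rightarrow> ('o, 'm, 'x) cset" where
  "empty_cset C = \<lparr>obj = (\<lambda>x\<in>Obj C. {}), act = (\<lambda>f\<in>Mor C. \<lambda>a\<in>{}. undefined)\<rparr>"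

definition one_cset :: "('o, 'm) cat \<Rightarrow> ('o, 'm, unit) cset" where
  "one_cset C = \<lparr>obj = (\<lambda>x\<in>Obj C. {()}), act = (\<lambda>f\<in>Mor C. \<lambda>a\<in>{()}. ())\<rparr>"

definition prod_cset ::
    "('o, 'm) cat \<Rightarrow> ('o, 'm, 'x) cset \<Rightarrow> ('o, 'm, 'y) cset \<Rightarrow> ('o, 'm, 'x \<times> 'y) cset" where
  "prod_cset C \<Omega> \<Psi> =
    \<lparr>obj = (\<lambda>x\<in>Obj C. obj \<Omega> x \<times> obj \<Psi> x),
     act = (\<lambda>f\<in>Mor C. \<lambda>p\<in>obj \<Omega> (Dom C f) \<times> obj \<Psi> (Dom C f).
       (act \<Omega> f (fst p), act \<Psi> f (snd p)))\<rparr>"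

definition simple :: "('o, 'm) cat \<Rightarrow> ('o, 'm, 'x) cset \<Rightarrow> bool" where
  "simple C S \<longleftrightarrow> is_cset C S \<and> S \<noteq> empty_cset C \<and>
    (\<forall>\<Phi>. csubset C \<Phi> S \<longrightarrow> \<Phi> = S \<or> \<Phi> = empty_cset C)"

definition simple_csubsets :: "('o, 'm) cat \<Rightarrow> ('o, 'm, 'x) cset \<Rightarrow> ('o, 'm, 'x) cset set" where
  "simple_csubsets C \<Omega> = {\<Phi>. csubset C \<Phi> \<Omega> \<and> simple C \<Phi>}"

definition soc :: "('o, 'm) cat \<Rightarrow> ('o, 'm, 'x) cset \<Rightarrow> ('o, 'm, 'x) cset" where
  "soc C \<Omega> =
    \<lparr>obj = (\<lambda>x\<in>Obj C. \<Union>\<Phi>\<in>simple_csubsets C \<Omega>. obj \<Phi> x),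
     act = (\<lambda>f\<in>Mor C. \<lambda>a\<in>(\<Union>\<Phi>\<in>simple_csubsets C \<Omega>. obj \<Phi> (Dom C f)). act \<Omega> f a)\<rparr>"

section \<open>The simple Burnside ring\<close>

text \<open>
  Every \<open>\<C>\<close>-set is isomorphic to one whose values are finite sets of natural numbers. So an
  isomorphism class is represented by its (non-empty) set of members over \<^typ>\<open>nat\<close>, which makes
  sense for a \<open>\<C>\<close>-set over an arbitrary type of elements.
\<close>

definition iso_class :: "('o, 'm) cat \<Rightarrow> ('o, 'm, 'x) cset \<Rightarrow> ('o, 'm, nat) cset set" where
  "iso_class C \<Omega> = {\<Psi>. is_cset C \<Psi> \<and> cset_iso C \<Omega> \<Psi>}"

definition rep :: "('o, 'm, nat) cset set \<Rightarrow> ('o, 'm, nat) cset" where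
  "rep c = (SOME \<Psi>. \<Psi> \<in> c)"

definition simple_classes :: "('o, 'm) cat \<Rightarrow> ('o, 'm, nat) cset set set" where
  "simple_classes C = {iso_class C S |S :: ('o, 'm, nat) cset. simple C S}"

text \<open>
  The class \<open>[\<Omega>]\<close> of a finite disjoint union \<open>\<Omega>\<close> of simple \<open>\<C>\<close>-sets in the free abelian group
  on the isomorphism classes of simple \<open>\<C>\<close>-sets: the simple summands of \<open>\<Omega>\<close> are exactly its
  simple \<open>\<C>\<close>-subsets.
\<close>

definition burnside_class ::
    "('o, 'm) cat \<Rightarrow> ('o, 'm, 'x) cset \<Rightarrow> ('o, 'm, nat) cset set \<Rightarrow>\<^sub>0 int" where
  "burnside_class C \<Omega> = (\<Sum>\<Phi>\<in>simple_csubsets C \<Omega>. frag_of (iso_class C \<Phi>))"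

text \<open>The bilinear extension of \<open>[S] \<star> [T] = [soc (S \<times> T)]\<close>.\<close>

definition burnside_mult ::
    "('o, 'm) cat \<Rightarrow> (('o, 'm, nat) cset set \<Rightarrow>\<^sub>0 int) \<Rightarrow> (('o, 'm, nat) cset set \<Rightarrow>\<^sub>0 int)
      \<Rightarrow> (('o, 'm, nat) cset set \<Rightarrow>\<^sub>0 int)" where
  "burnside_mult C u v =
    frag_extend (\<lambda>s. frag_extend (\<lambda>t. burnside_class C (soc C (prod_cset C (rep s) (rep t)))) v) u"

definition simple_burnside_ring :: "('o, 'm) cat \<Rightarrow> (('o, 'm, nat) cset set \<Rightarrow>\<^sub>0 int) ring" where
  "simple_burnside_ring C =
    \<lparr>carrier = carrier (free_Abelian_group (simple_classes C)),
     monoid.mult = burnside_mult C,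
     one = burnside_class C (soc C (one_cset C)),
     zero = 0,
     add = (+)\<rparr>"

text \<open>
  The additive extension of \<open>[T] \<mapsto> |Hom(S, T)|\<close> from the basis of classes of simple \<open>\<C>\<close>-sets \<open>T\<close>.
  It takes the value \<open>|Hom(S, \<Omega>)|\<close> at \<open>[\<Omega>]\<close>, because a morphism from a simple \<open>\<C>\<close>-set \<open>S\<close> has
  its image in exactly one simple summand of \<open>\<Omega>\<close>.
\<close>

definition mark ::
    "('o, 'm) cat \<Rightarrow> ('o, 'm, 'x) cset \<Rightarrow> (('o, 'm, nat) cset set \<Rightarrow>\<^sub>0 int) \<Rightarrow> int" where
  "mark C S u =
    (\<Sum>t\<in>Poly_Mapping.keys u. Poly_Mapping.lookup u t * int (card (Hom C S (rep t))))"

section \<open>Prime ideals\<close>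

definition Spec :: "('a, 'b) ring_scheme \<Rightarrow> 'a set set" where
  "Spec R = {P. primeideal P R}"

definition mark_ideal ::
    "('o, 'm) cat \<Rightarrow> ('o, 'm, 'x) cset \<Rightarrow> (('o, 'm, nat) cset set \<Rightarrow>\<^sub>0 int) set" where
  "mark_ideal C S = a_kernel (simple_burnside_ring C) \<Z> (mark C S)"

definition mark_ideal_mod ::
    "('o, 'm) cat \<Rightarrow> ('o, 'm, 'x) cset \<Rightarrow> nat \<Rightarrow> (('o, 'm, nat) cset set \<Rightarrow>\<^sub>0 int) set" where
  "mark_ideal_mod C S p = a_kernel (simple_burnside_ring C) (ZFact (int p))
    ((\<lambda>k. Idl\<^bsub>\<Z>\<^esub> {int p} +>\<^bsub>\<Z>\<^esub> k) \<circ> mark C S)"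

end

theory Submission
  imports Defs
begin

text \<open>
  The image of a simple \<open>\<C>\<close>-set under a morphism is simple. Hence \<open>Hom S \<Omega>\<close> is the disjoint union
  of the \<open>Hom S \<Phi>\<close> over the simple \<open>\<Phi> \<subseteq> \<Omega>\<close>, so passing to the socle does not change marks, and the
  marks are unital ring homomorphisms to \<open>\<int>\<close>. A morphism between simple \<open>\<C>\<close>-sets is surjective, so
  the table of marks is triangular for the order by size and the marks are jointly injective.
  There are only finitely many simple classes, because a simple \<open>\<C>\<close>-set is the orbit of any of its
  elements. So the product of the kernels of the marks is zero, a prime ideal \<open>P\<close> contains one of
  them, and \<open>P\<close> is then the preimage of a prime ideal of \<open>\<int>\<close> under that mark.
\<close>

section \<open>\<open>\<C>\<close>-sets and their morphisms\<close>

text \<open>A sub-C-set inherits its action, so only its family of sets carries information. Working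
  with such families avoids comparing records; values outside \<open>Obj C\<close> are left free and
  are cut off by \<open>restrict_cset\<close>.\<close>

definition closed_family ::
    "('o, 'm) cat \<Rightarrow> ('o, 'm, 'x) cset \<Rightarrow> ('o \<Rightarrow> 'x set) \<Rightarrow> bool" where
  "closed_family C \<Omega> A \<longleftrightarrow>
    (\<forall>x\<in>Obj C. A x \<subseteq> obj \<Omega> x) \<and>
    (\<forall>f\<in>Mor C. \<forall>a\<in>A (Dom C f). act \<Omega> f a \<in> A (Cod C f))"

definition restrict_cset ::
    "('o, 'm) cat \<Rightarrow> ('o, 'm, 'x) cset \<Rightarrow> ('o \<Rightarrow> 'x set) \<Rightarrow> ('o, 'm, 'x) cset" where
  "restrict_cset C \<Omega> A =
    \<lparr>obj = (\<lambda>x\<in>Obj C. A x), act = (\<lambda>f\<in>Mor C. \<lambda>a\<in>A (Dom C f). act \<Omega> f a)\<rparr>"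

definition image_cset ::
    "('o, 'm) cat \<Rightarrow> ('o, 'm, 'x) cset \<Rightarrow> ('o, 'm, 'y) cset \<Rightarrow> ('o \<Rightarrow> 'x \<Rightarrow> 'y) \<Rightarrow> ('o, 'm, 'y) cset"
  where "image_cset C \<Omega> \<Psi> \<eta> = restrict_cset C \<Psi> (\<lambda>x. \<eta> x ` obj \<Omega> x)"

definition comp_nat :: "('o, 'm) cat \<Rightarrow> ('o, 'm, 'x) cset \<Rightarrow> ('o \<Rightarrow> 'y \<Rightarrow> 'z) \<Rightarrow> ('o \<Rightarrow> 'x \<Rightarrow> 'y)
    \<Rightarrow> 'o \<Rightarrow> 'x \<Rightarrow> 'z" where
  "comp_nat C \<Omega> \<theta> \<eta> = (\<lambda>x\<in>Obj C. \<lambda>a\<in>obj \<Omega> x. \<theta> x (\<eta> x a))"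

definition id_nat :: "('o, 'm) cat \<Rightarrow> ('o, 'm, 'x) cset \<Rightarrow> 'o \<Rightarrow> 'x \<Rightarrow> 'x" where
  "id_nat C \<Omega> = (\<lambda>x\<in>Obj C. \<lambda>a\<in>obj \<Omega> x. a)"

text \<open>This is transport of structure along \<open>g\<close>: pull back by
  \<open>inv_into\<close>, act in \<Omega>, push forward. The formula is meaningful when each
  \<open>g x\<close> is injective on \<open>obj \<Omega> x\<close>.\<close>

definition transport_cset :: "('o, 'm) cat \<Rightarrow> ('o, 'm, 'x) cset \<Rightarrow> ('o \<Rightarrow> 'x \<Rightarrow> 'y) \<Rightarrow> ('o, 'm, 'y) cset"
  where "transport_cset C \<Omega> g =
    \<lparr>obj = (\<lambda>x\<in>Obj C. g x ` obj \<Omega> x),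
     act = (\<lambda>f\<in>Mor C. \<lambda>b\<in>g (Dom C f) ` obj \<Omega> (Dom C f).
       g (Cod C f) (act \<Omega> f (inv_into (obj \<Omega> (Dom C f)) (g (Dom C f)) b)))\<rparr>"

text \<open>This is the size by which the table of marks is triangular.\<close>

definition cset_size :: "('o, 'm) cat \<Rightarrow> ('o, 'm, 'x) cset \<Rightarrow> nat" where
  "cset_size C \<Omega> = (\<Sum>x\<in>Obj C. card (obj \<Omega> x))"

context finite_category
begin

lemma cset_finite: "is_cset C \<Omega> \<Longrightarrow> x \<in> Obj C \<Longrightarrow> finite (obj \<Omega> x)"
  unfolding is_cset_def by auto

lemma cset_act_in:
  "is_cset C \<Omega> \<Longrightarrow> f \<in> Mor C \<Longrightarrow> a \<in> obj \<Omega> (Dom C f) \<Longrightarrow> act \<Omega> f a \<in> obj \<Omega> (Cod C f)"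
  unfolding is_cset_def by (auto simp: PiE_def Pi_def)

text \<open>The codomain is a separate equation so that simplification can still apply the rule
  after rewriting \<open>Cod\<close> of an identity or a composite.\<close>

lemma cset_act_in':
  "is_cset C \<Omega> \<Longrightarrow> f \<in> Mor C \<Longrightarrow> Cod C f = y \<Longrightarrow> a \<in> obj \<Omega> (Dom C f) \<Longrightarrow> act \<Omega> f a \<in> obj \<Omega> y"
  using cset_act_in[of \<Omega> f a] by simp

lemma cset_act_Ide: "is_cset C \<Omega> \<Longrightarrow> x \<in> Obj C \<Longrightarrow> a \<in> obj \<Omega> x \<Longrightarrow> act \<Omega> (Ide C x) a = a"
  unfolding is_cset_def by auto

lemma cset_act_Cmp:
  "is_cset C \<Omega> \<Longrightarrow> f \<in> Mor C \<Longrightarrow> g \<in> Mor C \<Longrightarrow> Cod C f = Dom C g \<Longrightarrow> a \<in> obj \<Omega> (Dom C f) \<Longrightarrow>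
    act \<Omega> (Cmp C g f) a = act \<Omega> g (act \<Omega> f a)"
  unfolding is_cset_def by auto

lemma cset_eqI:
  fixes \<Omega> \<Psi> :: "('o, 'm, 'x) cset"
  assumes "is_cset C \<Omega>" "is_cset C \<Psi>"
    and o: "\<And>x. x \<in> Obj C \<Longrightarrow> obj \<Omega> x = obj \<Psi> x"
    and a: "\<And>f a. f \<in> Mor C \<Longrightarrow> a \<in> obj \<Omega> (Dom C f) \<Longrightarrow> act \<Omega> f a = act \<Psi> f a"
  shows "\<Omega> = \<Psi>"
proof (rule cset.equality)
  show obj: "obj \<Omega> = obj \<Psi>"
  proof (rule PiE_ext)
    show "obj \<Omega> \<in> Obj C \<rightarrow>\<^sub>E {X. finite X}" "obj \<Psi> \<in> Obj C \<rightarrow>\<^sub>E {X. finite X}"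
      using assms(1,2) by (simp_all add: is_cset_def)
  qed (rule o)
  show "act \<Omega> = act \<Psi>"
  proof (rule PiE_ext)
    show \<Omega>: "act \<Omega> \<in> (\<Pi>\<^sub>E f\<in>Mor C. obj \<Omega> (Dom C f) \<rightarrow>\<^sub>E obj \<Omega> (Cod C f))"
      using assms(1) unfolding is_cset_def by blast
    show \<Psi>: "act \<Psi> \<in> (\<Pi>\<^sub>E f\<in>Mor C. obj \<Omega> (Dom C f) \<rightarrow>\<^sub>E obj \<Omega> (Cod C f))"
      using assms(2) obj unfolding is_cset_def by simp
    show "act \<Omega> f = act \<Psi> f" if f: "f \<in> Mor C" for f
      using PiE_mem[OF \<Omega> f] PiE_mem[OF \<Psi> f] by (rule PiE_ext) (simp add: a f)
  qed
qed simp

section \<open>Sub-C-sets as closed families, and simplicity\<close>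

lemma obj_restrict_cset [simp]: "x \<in> Obj C \<Longrightarrow> obj (restrict_cset C \<Omega> A) x = A x"
  by (simp add: restrict_cset_def)

lemma act_restrict_cset [simp]:
  "f \<in> Mor C \<Longrightarrow> a \<in> A (Dom C f) \<Longrightarrow> act (restrict_cset C \<Omega> A) f a = act \<Omega> f a"
  by (simp add: restrict_cset_def)

lemma csubset_is_cset: "csubset C \<Phi> \<Omega> \<Longrightarrow> is_cset C \<Phi>"
  by (simp add: csubset_def)

lemma csubset_restrict_cset:
  assumes \<Omega>: "is_cset C \<Omega>" and A: "closed_family C \<Omega> A"
  shows "csubset C (restrict_cset C \<Omega> A) \<Omega>"
proof -
  have sub: "A x \<subseteq> obj \<Omega> x" if "x \<in> Obj C" for x
    using A that unfolding closed_family_def by blast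
  have cl: "act \<Omega> f a \<in> A (Cod C f)" if "f \<in> Mor C" "a \<in> A (Dom C f)" for f a
    using A that unfolding closed_family_def by blast
  have "is_cset C (restrict_cset C \<Omega> A)"
    unfolding is_cset_def
  proof (intro conjI ballI impI)
    show "obj (restrict_cset C \<Omega> A) \<in> Obj C \<rightarrow>\<^sub>E {X. finite X}"
      using cset_finite[OF \<Omega>] sub by (auto simp: restrict_cset_def intro: finite_subset)
    show "act (restrict_cset C \<Omega> A) \<in> (\<Pi>\<^sub>E f\<in>Mor C.
        obj (restrict_cset C \<Omega> A) (Dom C f) \<rightarrow>\<^sub>E obj (restrict_cset C \<Omega> A) (Cod C f))"
      using cl by (auto simp: restrict_cset_def Dom_in Cod_in)
  next
    fix x a assume "x \<in> Obj C" "a \<in> obj (restrict_cset C \<Omega> A) x"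
    moreover from this have "a \<in> obj \<Omega> x" using sub by auto
    ultimately show "act (restrict_cset C \<Omega> A) (Ide C x) a = a"
      by (simp add: Ide_in Dom_Ide cset_act_Ide[OF \<Omega>])
  next
    fix f g a
    assume *: "f \<in> Mor C" "g \<in> Mor C" "Cod C f = Dom C g"
      "a \<in> obj (restrict_cset C \<Omega> A) (Dom C f)"
    then have a: "a \<in> A (Dom C f)" by (simp add: Dom_in)
    then have "a \<in> obj \<Omega> (Dom C f)" using sub * Dom_in by blast
    then show "act (restrict_cset C \<Omega> A) (Cmp C g f) a =
        act (restrict_cset C \<Omega> A) g (act (restrict_cset C \<Omega> A) f a)"
      using * a cl[of f a] by (simp add: Cmp_in Dom_Cmp cset_act_Cmp[OF \<Omega>])
  qed
  then show ?thesis
    using sub by (auto simp: csubset_def Dom_in)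
qed

lemma closed_family_csubset:
  assumes "csubset C \<Phi> \<Omega>"
  shows "closed_family C \<Omega> (obj \<Phi>)"
  using assms cset_act_in[of \<Phi>] unfolding csubset_def closed_family_def by metis

lemma csubset_trans: "csubset C \<Phi> \<Psi> \<Longrightarrow> csubset C \<Psi> \<Omega> \<Longrightarrow> csubset C \<Phi> \<Omega>"
  unfolding csubset_def by (auto simp: Dom_in subset_eq)

lemma csubset_eqI:
  assumes "csubset C \<Phi> \<Omega>" "csubset C \<Psi> \<Omega>" "\<And>x. x \<in> Obj C \<Longrightarrow> obj \<Phi> x = obj \<Psi> x"
  shows "\<Phi> = \<Psi>"
  using assms by (intro cset_eqI) (auto simp: csubset_def Dom_in)

lemma csubset_refl: "is_cset C \<Omega> \<Longrightarrow> csubset C \<Omega> \<Omega>"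
  by (simp add: csubset_def)

lemma is_cset_empty: "is_cset C (empty_cset C)"
  by (auto simp: is_cset_def empty_cset_def Dom_in Cod_in)

lemma cset_eq_empty_iff: "is_cset C \<Omega> \<Longrightarrow> \<Omega> = empty_cset C \<longleftrightarrow> (\<forall>x\<in>Obj C. obj \<Omega> x = {})"
  using is_cset_empty by (auto simp: Dom_in intro!: cset_eqI) (auto simp: empty_cset_def)

text \<open>Closed families and sub-C-sets correspond through \<open>restrict_cset\<close> and
  \<open>obj\<close>. The right-hand side compares sets object by object, which is the form in which
  simplicity is proved and used below.\<close>

lemma simple_iff:
  "simple C S \<longleftrightarrow> is_cset C S \<and> (\<exists>x\<in>Obj C. obj S x \<noteq> {}) \<and>
    (\<forall>A. closed_family C S A \<longrightarrow> (\<forall>x\<in>Obj C. A x = obj S x) \<or> (\<forall>x\<in>Obj C. A x = {}))"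
  (is "_ \<longleftrightarrow> ?R")
proof
  assume S: "simple C S"
  then have cS: "is_cset C S" by (simp add: simple_def)
  have "(\<forall>x\<in>Obj C. A x = obj S x) \<or> (\<forall>x\<in>Obj C. A x = {})" if A: "closed_family C S A" for A
  proof -
    have sub: "csubset C (restrict_cset C S A) S"
      by (rule csubset_restrict_cset[OF cS A])
    then consider "restrict_cset C S A = S" | "restrict_cset C S A = empty_cset C"
      using S by (auto simp: simple_def)
    then show ?thesis
    proof cases
      case 1
      then show ?thesis by (metis obj_restrict_cset)
    next
      case 2
      then have "\<forall>x\<in>Obj C. obj (restrict_cset C S A) x = {}"
        using cset_eq_empty_iff[OF csubset_is_cset[OF sub]] by blast
      then show ?thesis by simp
    qed
  qed
  then show ?R
    using S cS cset_eq_empty_iff[OF cS] by (auto simp: simple_def)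
next
  assume R: ?R
  then have cS: "is_cset C S" by blast
  have "\<Phi> = S \<or> \<Phi> = empty_cset C" if \<Phi>: "csubset C \<Phi> S" for \<Phi>
    using R closed_family_csubset[OF \<Phi>] csubset_eqI[OF \<Phi> csubset_refl[OF cS]]
      cset_eq_empty_iff[OF csubset_is_cset[OF \<Phi>]] by blast
  then show "simple C S"
    using R cset_eq_empty_iff[OF cS] by (auto simp: simple_def)
qed

lemma simple_is_cset: "simple C S \<Longrightarrow> is_cset C S"
  by (simp add: simple_def)

lemma simple_nonempty: "simple C S \<Longrightarrow> \<exists>x\<in>Obj C. obj S x \<noteq> {}"
  by (simp add: simple_iff)

lemma simple_closed_family:
  assumes "simple C S" "closed_family C S A" "y \<in> Obj C" "A y \<noteq> {}" "x \<in> Obj C"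
  shows "A x = obj S x"
  using assms unfolding simple_iff by blast

lemma simple_csubset_eq:
  assumes "simple C S" "csubset C \<Phi> S" "simple C \<Phi>"
  shows "\<Phi> = S"
  using assms unfolding simple_def by blast

section \<open>Natural transformations and isomorphisms\<close>

lemma HomI:
  assumes "\<And>x. x \<in> Obj C \<Longrightarrow> \<eta> x \<in> obj \<Omega> x \<rightarrow>\<^sub>E obj \<Psi> x" "\<eta> \<in> extensional (Obj C)"
    and "\<And>f a. f \<in> Mor C \<Longrightarrow> a \<in> obj \<Omega> (Dom C f) \<Longrightarrow>
      \<eta> (Cod C f) (act \<Omega> f a) = act \<Psi> f (\<eta> (Dom C f) a)"
  shows "\<eta> \<in> Hom C \<Omega> \<Psi>"
  using assms by (auto simp: Hom_def PiE_iff)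

lemma Hom_in: "\<eta> \<in> Hom C \<Omega> \<Psi> \<Longrightarrow> x \<in> Obj C \<Longrightarrow> a \<in> obj \<Omega> x \<Longrightarrow> \<eta> x a \<in> obj \<Psi> x"
  by (auto simp: Hom_def PiE_iff)

lemma Hom_act:
  "\<eta> \<in> Hom C \<Omega> \<Psi> \<Longrightarrow> f \<in> Mor C \<Longrightarrow> a \<in> obj \<Omega> (Dom C f) \<Longrightarrow>
    \<eta> (Cod C f) (act \<Omega> f a) = act \<Psi> f (\<eta> (Dom C f) a)"
  by (auto simp: Hom_def)

lemma Hom_eqI:
  assumes "\<eta> \<in> Hom C \<Omega> \<Psi>" "\<theta> \<in> Hom C \<Omega> \<Psi>'"
    and eq: "\<And>x a. x \<in> Obj C \<Longrightarrow> a \<in> obj \<Omega> x \<Longrightarrow> \<eta> x a = \<theta> x a"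
  shows "\<eta> = \<theta>"
proof (rule extensionalityI[of _ "Obj C"])
  show "\<eta> x = \<theta> x" if "x \<in> Obj C" for x
    using assms that by (intro extensionalityI[of _ "obj \<Omega> x"]) (auto simp: Hom_def PiE_iff)
qed (use assms in \<open>auto simp: Hom_def PiE_iff\<close>)

lemma finite_Hom:
  assumes "is_cset C \<Omega>" "is_cset C \<Psi>"
  shows "finite (Hom C \<Omega> \<Psi>)"
proof (rule finite_subset)
  show "Hom C \<Omega> \<Psi> \<subseteq> (\<Pi>\<^sub>E x\<in>Obj C. obj \<Omega> x \<rightarrow>\<^sub>E obj \<Psi> x)"
    by (auto simp: Hom_def)
  show "finite (\<Pi>\<^sub>E x\<in>Obj C. obj \<Omega> x \<rightarrow>\<^sub>E obj \<Psi> x)"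
    using assms by (intro finite_PiE finite_Obj) (auto intro: cset_finite)
qed

lemma comp_nat_in_Hom:
  assumes "is_cset C \<Omega>" "\<eta> \<in> Hom C \<Omega> \<Psi>" "\<theta> \<in> Hom C \<Psi> \<Xi>"
  shows "comp_nat C \<Omega> \<theta> \<eta> \<in> Hom C \<Omega> \<Xi>"
  using assms by (intro HomI) (auto simp: comp_nat_def Hom_in Hom_act Dom_in Cod_in cset_act_in)

lemma id_nat_in_Hom: "is_cset C \<Omega> \<Longrightarrow> id_nat C \<Omega> \<in> Hom C \<Omega> \<Omega>"
  by (intro HomI) (auto simp: id_nat_def Dom_in Cod_in cset_act_in)

lemma cset_iso_sym: "cset_iso C \<Omega> \<Psi> \<Longrightarrow> cset_iso C \<Psi> \<Omega>"
  unfolding cset_iso_def by blast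

lemma cset_iso_trans:
  assumes "is_cset C \<Omega>" "is_cset C \<Xi>" "cset_iso C \<Omega> \<Psi>" "cset_iso C \<Psi> \<Xi>"
  shows "cset_iso C \<Omega> \<Xi>"
proof -
  obtain \<eta> \<theta> where 1: "\<eta> \<in> Hom C \<Omega> \<Psi>" "\<theta> \<in> Hom C \<Psi> \<Omega>"
    and i1: "\<And>x. x \<in> Obj C \<Longrightarrow> (\<forall>a\<in>obj \<Omega> x. \<theta> x (\<eta> x a) = a) \<and> (\<forall>b\<in>obj \<Psi> x. \<eta> x (\<theta> x b) = b)"
    using assms(3) unfolding cset_iso_def by blast
  obtain \<eta>' \<theta>' where 2: "\<eta>' \<in> Hom C \<Psi> \<Xi>" "\<theta>' \<in> Hom C \<Xi> \<Psi>"
    and i2: "\<And>x. x \<in> Obj C \<Longrightarrow> (\<forall>a\<in>obj \<Psi> x. \<theta>' x (\<eta>' x a) = a) \<and> (\<forall>b\<in>obj \<Xi> x. \<eta>' x (\<theta>' x b) = b)"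
    using assms(4) unfolding cset_iso_def by blast
  have "comp_nat C \<Omega> \<eta>' \<eta> \<in> Hom C \<Omega> \<Xi>" "comp_nat C \<Xi> \<theta> \<theta>' \<in> Hom C \<Xi> \<Omega>"
    using assms 1 2 by (auto intro: comp_nat_in_Hom)
  then show ?thesis
    unfolding cset_iso_def using i1 i2 1 2
    by (intro bexI[of _ "comp_nat C \<Omega> \<eta>' \<eta>"] bexI[of _ "comp_nat C \<Xi> \<theta> \<theta>'"])
      (auto simp: comp_nat_def Hom_in)
qed

text \<open>Postcomposition with an isomorphism is a bijection, inverse to postcomposition with its
  inverse. Hence a mark may be computed on any representative of a class.\<close>

lemma card_Hom_cong:
  assumes S: "is_cset C S" and \<Omega>: "is_cset C \<Omega>" and \<Psi>: "is_cset C \<Psi>" and iso: "cset_iso C \<Omega> \<Psi>"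
  shows "card (Hom C S \<Omega>) = card (Hom C S \<Psi>)"
proof -
  obtain \<eta> \<theta> where 1: "\<eta> \<in> Hom C \<Omega> \<Psi>" "\<theta> \<in> Hom C \<Psi> \<Omega>"
    and i1: "\<And>x. x \<in> Obj C \<Longrightarrow> (\<forall>a\<in>obj \<Omega> x. \<theta> x (\<eta> x a) = a) \<and> (\<forall>b\<in>obj \<Psi> x. \<eta> x (\<theta> x b) = b)"
    using iso unfolding cset_iso_def by blast
  have "bij_betw (comp_nat C S \<eta>) (Hom C S \<Omega>) (Hom C S \<Psi>)"
  proof (rule bij_betw_byWitness[of _ "comp_nat C S \<theta>"])
    show "\<forall>\<alpha>\<in>Hom C S \<Omega>. comp_nat C S \<theta> (comp_nat C S \<eta> \<alpha>) = \<alpha>"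
      using S 1 i1 by (auto intro!: Hom_eqI comp_nat_in_Hom) (simp add: comp_nat_def Hom_in)
    show "\<forall>\<alpha>\<in>Hom C S \<Psi>. comp_nat C S \<eta> (comp_nat C S \<theta> \<alpha>) = \<alpha>"
      using S 1 i1 by (auto intro!: Hom_eqI comp_nat_in_Hom) (simp add: comp_nat_def Hom_in)
  qed (use S 1 in \<open>auto intro: comp_nat_in_Hom\<close>)
  then show ?thesis by (rule bij_betw_same_card)
qed

section \<open>Images, and counting morphisms out of a simple C-set\<close>

lemma closed_family_image:
  assumes "is_cset C \<Omega>" "\<eta> \<in> Hom C \<Omega> \<Psi>"
  shows "closed_family C \<Psi> (\<lambda>x. \<eta> x ` obj \<Omega> x)"
  unfolding closed_family_def
proof (intro conjI ballI)
  fix f b assume f: "f \<in> Mor C" and "b \<in> \<eta> (Dom C f) ` obj \<Omega> (Dom C f)"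
  then obtain a where "a \<in> obj \<Omega> (Dom C f)" "b = \<eta> (Dom C f) a" by blast
  then show "act \<Psi> f b \<in> \<eta> (Cod C f) ` obj \<Omega> (Cod C f)"
    using Hom_act[OF assms(2) f] cset_act_in[OF assms(1) f] by (metis imageI)
qed (use assms in \<open>auto simp: Hom_in\<close>)

lemma csubset_image_cset:
  "is_cset C \<Omega> \<Longrightarrow> is_cset C \<Psi> \<Longrightarrow> \<eta> \<in> Hom C \<Omega> \<Psi> \<Longrightarrow> csubset C (image_cset C \<Omega> \<Psi> \<eta>) \<Psi>"
  unfolding image_cset_def by (intro csubset_restrict_cset closed_family_image)

lemma obj_image_cset [simp]: "x \<in> Obj C \<Longrightarrow> obj (image_cset C \<Omega> \<Psi> \<eta>) x = \<eta> x ` obj \<Omega> x"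
  by (simp add: image_cset_def)

text \<open>A closed family in the image pulls back along \<eta> to a closed family in
  \<open>S\<close>, which is everything or empty. Every element of the image has a preimage, so the
  same alternative passes to the image.\<close>

lemma simple_image_cset:
  assumes S: "simple C S" and \<Omega>: "is_cset C \<Omega>" and \<eta>: "\<eta> \<in> Hom C S \<Omega>"
  shows "simple C (image_cset C S \<Omega> \<eta>)"
  unfolding simple_iff
proof (intro conjI allI impI)
  note cS = simple_is_cset[OF S]
  show cI: "is_cset C (image_cset C S \<Omega> \<eta>)"
    using csubset_image_cset[OF cS \<Omega> \<eta>] by (rule csubset_is_cset)
  show "\<exists>x\<in>Obj C. obj (image_cset C S \<Omega> \<eta>) x \<noteq> {}"
    using simple_nonempty[OF S] by simp
  fix A assume A: "closed_family C (image_cset C S \<Omega> \<eta>) A"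
  then have sub: "A x \<subseteq> \<eta> x ` obj S x" if "x \<in> Obj C" for x
    using that by (auto simp: closed_family_def)
  \<comment> \<open>The family lies inside the image, where the restricted action agrees with that
    of \<Omega>.\<close>
  have cl: "act \<Omega> f b \<in> A (Cod C f)" if "f \<in> Mor C" "b \<in> A (Dom C f)" for f b
  proof -
    have "act (image_cset C S \<Omega> \<eta>) f b = act \<Omega> f b"
      using that sub[of "Dom C f"] Dom_in by (auto simp: image_cset_def)
    then show ?thesis using A that unfolding closed_family_def by metis
  qed
  let ?B = "\<lambda>x. {a \<in> obj S x. \<eta> x a \<in> A x}"
  have "closed_family C S ?B"
    using cl by (auto simp: closed_family_def cset_act_in[OF cS] Hom_act[OF \<eta>])
  then have "(\<forall>x\<in>Obj C. ?B x = obj S x) \<or> (\<forall>x\<in>Obj C. ?B x = {})"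
    using S unfolding simple_iff by blast
  then show "(\<forall>x\<in>Obj C. A x = obj (image_cset C S \<Omega> \<eta>) x) \<or> (\<forall>x\<in>Obj C. A x = {})"
  proof
    assume "\<forall>x\<in>Obj C. ?B x = obj S x"
    then show ?thesis using sub by fastforce
  next
    assume "\<forall>x\<in>Obj C. ?B x = {}"
    then show ?thesis using sub by fastforce
  qed
qed

lemma Hom_csubset:
  assumes "csubset C \<Phi> \<Omega>"
  shows "Hom C S \<Phi> \<subseteq> Hom C S \<Omega>"
proof
  fix \<eta> assume \<eta>: "\<eta> \<in> Hom C S \<Phi>"
  show "\<eta> \<in> Hom C S \<Omega>"
  proof (rule HomI)
    show "\<eta> x \<in> obj S x \<rightarrow>\<^sub>E obj \<Omega> x" if "x \<in> Obj C" for x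
    proof -
      have "obj \<Phi> x \<subseteq> obj \<Omega> x" using assms that unfolding csubset_def by blast
      then show ?thesis using \<eta> that by (auto simp: Hom_def PiE_iff)
    qed
    show "\<eta> \<in> extensional (Obj C)" using \<eta> by (auto simp: Hom_def PiE_iff)
    show "\<eta> (Cod C f) (act S f a) = act \<Omega> f (\<eta> (Dom C f) a)"
      if "f \<in> Mor C" "a \<in> obj S (Dom C f)" for f a
      using that Hom_act[OF \<eta>] Hom_in[OF \<eta>] assms Dom_in unfolding csubset_def by metis
  qed
qed

lemma Hom_image_cset:
  assumes "is_cset C S" "\<eta> \<in> Hom C S \<Omega>"
  shows "\<eta> \<in> Hom C S (image_cset C S \<Omega> \<eta>)"
proof (rule HomI)
  show "\<eta> x \<in> obj S x \<rightarrow>\<^sub>E obj (image_cset C S \<Omega> \<eta>) x" if "x \<in> Obj C" for x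
    using assms that by (auto simp: Hom_def PiE_iff)
  show "\<eta> \<in> extensional (Obj C)" using assms by (auto simp: Hom_def PiE_iff)
  show "\<eta> (Cod C f) (act S f a) = act (image_cset C S \<Omega> \<eta>) f (\<eta> (Dom C f) a)"
    if "f \<in> Mor C" "a \<in> obj S (Dom C f)" for f a
    using that assms by (auto simp: image_cset_def Hom_act)
qed

text \<open>The image is a simple sub-C-set of the simple \<open>T\<close>, so it is
  \<open>T\<close>.\<close>

lemma simple_Hom_surj:
  assumes "simple C S" "simple C T" "\<eta> \<in> Hom C S T" "x \<in> Obj C"
  shows "\<eta> x ` obj S x = obj T x"
proof -
  have "image_cset C S T \<eta> = T"
    using assms by (intro simple_csubset_eq csubset_image_cset simple_image_cset simple_is_cset)
  then show ?thesis using assms(4) by (metis obj_image_cset)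
qed

text \<open>A sub-C-set is determined by its family \<open>obj\<close>, and this family lies in a
  finite product of power sets.\<close>

lemma finite_simple_csubsets:
  assumes "is_cset C \<Omega>"
  shows "finite (simple_csubsets C \<Omega>)"
proof (rule finite_imageD)
  show "finite (obj ` simple_csubsets C \<Omega>)"
  proof (rule finite_subset)
    show "obj ` simple_csubsets C \<Omega> \<subseteq> (\<Pi>\<^sub>E x\<in>Obj C. Pow (obj \<Omega> x))"
    proof (intro image_subsetI PiE_I)
      fix \<Phi> x assume \<Phi>: "\<Phi> \<in> simple_csubsets C \<Omega>"
      then show "obj \<Phi> x \<in> Pow (obj \<Omega> x)" if "x \<in> Obj C"
        using that by (auto simp: simple_csubsets_def csubset_def)
      show "obj \<Phi> x = undefined" if "x \<notin> Obj C"
        using \<Phi> that unfolding simple_csubsets_def csubset_def is_cset_def by blast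
    qed
    show "finite (\<Pi>\<^sub>E x\<in>Obj C. Pow (obj \<Omega> x))"
      using assms by (intro finite_PiE finite_Obj) (auto intro: cset_finite)
  qed
  show "inj_on obj (simple_csubsets C \<Omega>)"
    by (rule inj_onI) (auto simp: simple_csubsets_def intro: csubset_eqI)
qed

text \<open>Every morphism from \<open>S\<close> lands in exactly one simple sub-C-set, namely its
  image. This is why the additive extension in \<open>mark\<close> still counts morphisms.\<close>

lemma card_Hom_simple:
  assumes S: "simple C S" and \<Omega>: "is_cset C \<Omega>"
  shows "card (Hom C S \<Omega>) = (\<Sum>\<Phi>\<in>simple_csubsets C \<Omega>. card (Hom C S \<Phi>))"
proof -
  note cS = simple_is_cset[OF S]
  \<comment> \<open>A morphism into a simple \<Phi> is onto, so it determines \<Phi>; this gives the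
    disjointness of the union below.\<close>
  have eq: "\<Phi> = image_cset C S \<Omega> \<eta>" if "\<Phi> \<in> simple_csubsets C \<Omega>" "\<eta> \<in> Hom C S \<Phi>" for \<Phi> \<eta>
  proof -
    have \<Phi>: "csubset C \<Phi> \<Omega>" "simple C \<Phi>" using that by (auto simp: simple_csubsets_def)
    then have "\<eta> \<in> Hom C S \<Omega>" using that(2) Hom_csubset by blast
    then show ?thesis
      using \<Phi> S \<Omega> cS that(2)
      by (intro csubset_eqI[OF _ csubset_image_cset]) (auto simp: simple_Hom_surj)
  qed
  have "Hom C S \<Omega> = (\<Union>\<Phi>\<in>simple_csubsets C \<Omega>. Hom C S \<Phi>)"
  proof (intro subset_antisym subsetI)
    fix \<eta> assume \<eta>: "\<eta> \<in> Hom C S \<Omega>"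
    have "image_cset C S \<Omega> \<eta> \<in> simple_csubsets C \<Omega>"
      using csubset_image_cset[OF cS \<Omega> \<eta>] simple_image_cset[OF S \<Omega> \<eta>]
      by (simp add: simple_csubsets_def)
    then show "\<eta> \<in> (\<Union>\<Phi>\<in>simple_csubsets C \<Omega>. Hom C S \<Phi>)"
      using Hom_image_cset[OF cS \<eta>] by blast
  next
    fix \<eta> assume "\<eta> \<in> (\<Union>\<Phi>\<in>simple_csubsets C \<Omega>. Hom C S \<Phi>)"
    then show "\<eta> \<in> Hom C S \<Omega>"
      using Hom_csubset by (fastforce simp: simple_csubsets_def)
  qed
  also have "card \<dots> = (\<Sum>\<Phi>\<in>simple_csubsets C \<Omega>. card (Hom C S \<Phi>))"
  proof (rule card_UN_disjoint)
    show "finite (simple_csubsets C \<Omega>)" by (rule finite_simple_csubsets[OF \<Omega>])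
    show "\<forall>\<Phi>\<in>simple_csubsets C \<Omega>. finite (Hom C S \<Phi>)"
      using cS by (auto simp: simple_csubsets_def intro: finite_Hom simple_is_cset)
    show "\<forall>\<Phi>\<in>simple_csubsets C \<Omega>. \<forall>\<Phi>'\<in>simple_csubsets C \<Omega>. \<Phi> \<noteq> \<Phi>' \<longrightarrow> Hom C S \<Phi> \<inter> Hom C S \<Phi>' = {}"
      using eq by blast
  qed
  finally show ?thesis .
qed

section \<open>Socles, products and the terminal C-set\<close>

lemma soc_eq_restrict_cset:
  "soc C \<Omega> = restrict_cset C \<Omega> (\<lambda>x. \<Union>\<Phi>\<in>simple_csubsets C \<Omega>. obj \<Phi> x)"
  by (simp add: soc_def restrict_cset_def)

lemma csubset_soc:
  assumes "is_cset C \<Omega>"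
  shows "csubset C (soc C \<Omega>) \<Omega>"
  unfolding soc_eq_restrict_cset using assms
proof (rule csubset_restrict_cset)
  show "closed_family C \<Omega> (\<lambda>x. \<Union>\<Phi>\<in>simple_csubsets C \<Omega>. obj \<Phi> x)"
    using closed_family_csubset unfolding closed_family_def simple_csubsets_def by fastforce
qed

text \<open>Each simple sub-C-set is contained in the socle by construction. Together with
  \<open>card_Hom_simple\<close> this makes socles invisible to marks.\<close>

lemma simple_csubsets_soc:
  assumes "is_cset C \<Omega>"
  shows "simple_csubsets C (soc C \<Omega>) = simple_csubsets C \<Omega>"
proof (intro subset_antisym subsetI)
  fix \<Phi> assume "\<Phi> \<in> simple_csubsets C (soc C \<Omega>)"
  then show "\<Phi> \<in> simple_csubsets C \<Omega>"
    using csubset_trans csubset_soc[OF assms] by (auto simp: simple_csubsets_def)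
next
  fix \<Phi> assume \<Phi>: "\<Phi> \<in> simple_csubsets C \<Omega>"
  then have "csubset C \<Phi> \<Omega>" by (simp add: simple_csubsets_def)
  then have "csubset C \<Phi> (soc C \<Omega>)"
    unfolding csubset_def soc_eq_restrict_cset using \<Phi>
    by (auto intro!: act_restrict_cset[symmetric])
  then show "\<Phi> \<in> simple_csubsets C (soc C \<Omega>)"
    using \<Phi> by (auto simp: simple_csubsets_def)
qed

lemma is_cset_prod:
  "is_cset C \<Omega> \<Longrightarrow> is_cset C \<Psi> \<Longrightarrow> is_cset C (prod_cset C \<Omega> \<Psi>)"
  unfolding is_cset_def[of C "prod_cset C \<Omega> \<Psi>"]
  by (auto simp: prod_cset_def Dom_in Cod_in Ide_in Dom_Ide Cod_Ide Cmp_in Dom_Cmp Cod_Cmp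
      cset_finite cset_act_in' cset_act_Ide cset_act_Cmp)

lemma is_cset_one: "is_cset C (one_cset C)"
  by (auto simp: is_cset_def one_cset_def Dom_in Cod_in Ide_in Cmp_in)

text \<open>This is the universal property of the product: \<open>?F\<close> pairs two morphisms and
  \<open>?G\<close> takes components, both restricted so that the results are extensional.\<close>

lemma card_Hom_prod:
  assumes S: "is_cset C S"
  shows "card (Hom C S (prod_cset C \<Omega> \<Psi>)) = card (Hom C S \<Omega>) * card (Hom C S \<Psi>)"
proof -
  let ?F = "\<lambda>(\<eta>, \<theta>). \<lambda>x\<in>Obj C. \<lambda>a\<in>obj S x. (\<eta> x a, \<theta> x a)"
  let ?G = "\<lambda>\<zeta>. (\<lambda>x\<in>Obj C. \<lambda>a\<in>obj S x. fst (\<zeta> x a), \<lambda>x\<in>Obj C. \<lambda>a\<in>obj S x. snd (\<zeta> x a))"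
  have pobj: "obj (prod_cset C \<Omega> \<Psi>) x = obj \<Omega> x \<times> obj \<Psi> x" if "x \<in> Obj C" for x
    using that by (simp add: prod_cset_def)
  have pact: "act (prod_cset C \<Omega> \<Psi>) f p = (act \<Omega> f (fst p), act \<Psi> f (snd p))"
    if "f \<in> Mor C" "p \<in> obj \<Omega> (Dom C f) \<times> obj \<Psi> (Dom C f)" for f p
    using that by (simp add: prod_cset_def)
  have F: "?F (\<eta>, \<theta>) \<in> Hom C S (prod_cset C \<Omega> \<Psi>)"
    if "\<eta> \<in> Hom C S \<Omega>" "\<theta> \<in> Hom C S \<Psi>" for \<eta> \<theta>
    using that by (intro HomI)
      (auto simp: pobj pact Dom_in Cod_in Hom_in Hom_act cset_act_in[OF S])
  have G: "fst (?G \<zeta>) \<in> Hom C S \<Omega> \<and> snd (?G \<zeta>) \<in> Hom C S \<Psi>"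
    if \<zeta>: "\<zeta> \<in> Hom C S (prod_cset C \<Omega> \<Psi>)" for \<zeta>
  proof -
    have m: "\<zeta> x a \<in> obj \<Omega> x \<times> obj \<Psi> x" if "x \<in> Obj C" "a \<in> obj S x" for x a
      using Hom_in[OF \<zeta> that] pobj that by simp
    then have m': "fst (\<zeta> x a) \<in> obj \<Omega> x" "snd (\<zeta> x a) \<in> obj \<Psi> x" if "x \<in> Obj C" "a \<in> obj S x" for x a
      using that by (metis mem_Times_iff)+
    show ?thesis
      by (intro conjI HomI) (auto simp: m m' pact Dom_in Cod_in Hom_act[OF \<zeta>] cset_act_in[OF S])
  qed
  have "bij_betw ?F (Hom C S \<Omega> \<times> Hom C S \<Psi>) (Hom C S (prod_cset C \<Omega> \<Psi>))"
  proof (rule bij_betw_byWitness[of _ ?G])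
    show "\<forall>p\<in>Hom C S \<Omega> \<times> Hom C S \<Psi>. ?G (?F p) = p"
    proof
      fix p assume p: "p \<in> Hom C S \<Omega> \<times> Hom C S \<Psi>"
      then have Fp: "?F p \<in> Hom C S (prod_cset C \<Omega> \<Psi>)" using F by auto
      have "fst (?G (?F p)) = fst p"
        using p G[OF Fp] by (intro Hom_eqI[of _ S \<Omega> _ \<Omega>]) (auto simp: split_beta)
      moreover have "snd (?G (?F p)) = snd p"
        using p G[OF Fp] by (intro Hom_eqI[of _ S \<Psi> _ \<Psi>]) (auto simp: split_beta)
      ultimately show "?G (?F p) = p" by (rule prod_eqI)
    qed
    show "\<forall>\<zeta>\<in>Hom C S (prod_cset C \<Omega> \<Psi>). ?F (?G \<zeta>) = \<zeta>"
    proof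
      fix \<zeta> assume \<zeta>: "\<zeta> \<in> Hom C S (prod_cset C \<Omega> \<Psi>)"
      show "?F (?G \<zeta>) = \<zeta>"
        using F[of "fst (?G \<zeta>)" "snd (?G \<zeta>)"] G[OF \<zeta>] \<zeta> by (intro Hom_eqI[OF _ \<zeta>]) auto
    qed
    show "?F ` (Hom C S \<Omega> \<times> Hom C S \<Psi>) \<subseteq> Hom C S (prod_cset C \<Omega> \<Psi>)"
      using F by auto
    show "?G ` Hom C S (prod_cset C \<Omega> \<Psi>) \<subseteq> Hom C S \<Omega> \<times> Hom C S \<Psi>"
      using G unfolding image_subset_iff mem_Times_iff by blast
  qed
  then show ?thesis
    using bij_betw_same_card by (fastforce simp: card_cartesian_product)
qed

text \<open>\<open>one_cset C\<close> is terminal.\<close>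

lemma card_Hom_one:
  assumes S: "is_cset C S"
  shows "card (Hom C S (one_cset C)) = 1"
proof -
  let ?\<eta> = "\<lambda>x\<in>Obj C. \<lambda>a\<in>obj S x. ()"
  have \<eta>: "?\<eta> \<in> Hom C S (one_cset C)"
    by (intro HomI) (auto simp: one_cset_def Dom_in Cod_in cset_act_in[OF S])
  have "Hom C S (one_cset C) = {?\<eta>}"
    using \<eta> by (auto intro: Hom_eqI)
  then show ?thesis by simp
qed

section \<open>Transport of structure and representatives over \<open>nat\<close>\<close>

lemma cset_iso_transport:
  assumes \<Omega>: "is_cset C \<Omega>" and inj: "\<And>x. x \<in> Obj C \<Longrightarrow> inj_on (g x) (obj \<Omega> x)"
  shows "is_cset C (transport_cset C \<Omega> g)" and "cset_iso C \<Omega> (transport_cset C \<Omega> g)"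
proof -
  let ?T = "transport_cset C \<Omega> g"
  let ?\<eta> = "\<lambda>x\<in>Obj C. \<lambda>a\<in>obj \<Omega> x. g x a"
  let ?\<theta> = "\<lambda>x\<in>Obj C. \<lambda>b\<in>g x ` obj \<Omega> x. inv_into (obj \<Omega> x) (g x) b"
  have tobj: "obj ?T x = g x ` obj \<Omega> x" if "x \<in> Obj C" for x
    using that by (simp add: transport_cset_def)
  have tact: "act ?T f (g (Dom C f) a) = g (Cod C f) (act \<Omega> f a)"
    if "f \<in> Mor C" "a \<in> obj \<Omega> (Dom C f)" for f a
    using that inj by (simp add: transport_cset_def Dom_in)
  \<comment> \<open>The object is a variable tied to \<open>Dom C f\<close> by an equation, so that
    the rule also matches when \<open>f\<close> is an identity or a composite.\<close>
  have tact': "act ?T f (g x a) = g (Cod C f) (act \<Omega> f a)"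
    if "f \<in> Mor C" "x = Dom C f" "a \<in> obj \<Omega> x" for f x a
    using that tact by simp
  show "is_cset C ?T"
    unfolding is_cset_def
  proof (intro conjI ballI impI)
    show "obj ?T \<in> Obj C \<rightarrow>\<^sub>E {X. finite X}"
      using cset_finite[OF \<Omega>] by (auto simp: transport_cset_def)
    show "act ?T \<in> (\<Pi>\<^sub>E f\<in>Mor C. obj ?T (Dom C f) \<rightarrow>\<^sub>E obj ?T (Cod C f))"
      using cset_act_in[OF \<Omega>] inj by (auto simp: transport_cset_def Dom_in Cod_in)
    show "act ?T (Ide C x) b = b" if "x \<in> Obj C" "b \<in> obj ?T x" for x b
      using that by (auto simp: tobj tact' Ide_in Dom_Ide Cod_Ide cset_act_Ide[OF \<Omega>])
    show "act ?T (Cmp C h f) b = act ?T h (act ?T f b)"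
      if "f \<in> Mor C" "h \<in> Mor C" "Cod C f = Dom C h" and b: "b \<in> obj ?T (Dom C f)" for f h b
    proof -
      obtain a where a: "a \<in> obj \<Omega> (Dom C f)" "b = g (Dom C f) a"
        using b tobj[OF Dom_in[OF \<open>f \<in> Mor C\<close>]] by blast
      have "act ?T h (act ?T f b) = g (Cod C h) (act \<Omega> h (act \<Omega> f a))"
        using a that cset_act_in[OF \<Omega> that(1) a(1)] by (simp add: tact)
      also have "\<dots> = act ?T (Cmp C h f) b"
        using a that tact'[of "Cmp C h f" "Dom C f" a]
        by (simp add: Cmp_in Dom_Cmp Cod_Cmp cset_act_Cmp[OF \<Omega>])
      finally show ?thesis by simp
    qed
  qed
  have \<eta>: "?\<eta> \<in> Hom C \<Omega> ?T"
    by (intro HomI) (auto simp: tobj tact Dom_in Cod_in cset_act_in[OF \<Omega>])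
  have \<theta>: "?\<theta> \<in> Hom C ?T \<Omega>"
  proof (intro HomI)
    fix f b assume f: "f \<in> Mor C" and "b \<in> obj ?T (Dom C f)"
    then obtain a where a: "a \<in> obj \<Omega> (Dom C f)" "b = g (Dom C f) a"
      using tobj[OF Dom_in[OF f]] by blast
    then show "?\<theta> (Cod C f) (act ?T f b) = act \<Omega> f (?\<theta> (Dom C f) b)"
      using f by (simp add: tact inj Dom_in Cod_in cset_act_in[OF \<Omega>])
  qed (auto simp: tobj inj)
  show "cset_iso C \<Omega> ?T"
    unfolding cset_iso_def
    by (rule bexI[OF _ \<eta>], rule bexI[OF _ \<theta>]) (auto simp: tobj inj)
qed

text \<open>An isomorphism is onto, so \<open>T\<close> is the image of the simple
  \<open>S\<close>.\<close>

lemma simple_cong: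
  assumes "simple C S" "is_cset C T" "cset_iso C S T"
  shows "simple C T"
proof -
  obtain \<eta> \<theta> where 1: "\<eta> \<in> Hom C S T" "\<theta> \<in> Hom C T S"
    and i: "\<And>x. x \<in> Obj C \<Longrightarrow> (\<forall>b\<in>obj T x. \<eta> x (\<theta> x b) = b)"
    using assms(3) unfolding cset_iso_def by blast
  have "\<eta> x ` obj S x = obj T x" if x: "x \<in> Obj C" for x
    using Hom_in[OF 1(1) x] Hom_in[OF 1(2) x] i[OF x] by force
  then have "image_cset C S T \<eta> = T"
    using assms 1(1)
    by (intro csubset_eqI[OF csubset_image_cset csubset_refl]) (auto intro: simple_is_cset)
  then show ?thesis using simple_image_cset[OF assms(1,2) 1(1)] by simp
qed

text \<open>The values are numbered by naturals below a common bound. Existence makes isomorphism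
  classes non-empty; the bound makes the simple classes finite in number.\<close>

lemma ex_nat_cset_iso:
  fixes \<Omega> :: "('o, 'm, 'x) cset"
  assumes \<Omega>: "is_cset C \<Omega>" and N: "\<And>x. x \<in> Obj C \<Longrightarrow> card (obj \<Omega> x) \<le> N"
  obtains \<Psi> :: "('o, 'm, nat) cset"
  where "is_cset C \<Psi>" "cset_iso C \<Omega> \<Psi>" "\<And>x. x \<in> Obj C \<Longrightarrow> obj \<Psi> x \<subseteq> {..<N}"
proof -
  have "\<exists>h. inj_on h (obj \<Omega> x) \<and> h ` obj \<Omega> x \<subseteq> {..<N}" if "x \<in> Obj C" for x
    using card_le_inj[of "obj \<Omega> x" "{..<N}"] cset_finite[OF \<Omega>] N that by auto
  then obtain g where g: "\<And>x. x \<in> Obj C \<Longrightarrow> inj_on (g x) (obj \<Omega> x)"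
    "\<And>x. x \<in> Obj C \<Longrightarrow> g x ` obj \<Omega> x \<subseteq> {..<N}"
    by metis
  show thesis
    using that[OF cset_iso_transport[OF \<Omega> g(1)]] g(2) by (simp add: transport_cset_def)
qed

lemma iso_class_nonempty:
  assumes "is_cset C \<Omega>"
  shows "iso_class C \<Omega> \<noteq> {}"
proof -
  have "card (obj \<Omega> x) \<le> cset_size C \<Omega>" if "x \<in> Obj C" for x
    unfolding cset_size_def using finite_Obj that by (intro member_le_sum) auto
  then show ?thesis
    using ex_nat_cset_iso[OF assms] unfolding iso_class_def by blast
qed

lemma rep_iso_class:
  assumes "is_cset C \<Omega>"
  shows "is_cset C (rep (iso_class C \<Omega>))" and "cset_iso C \<Omega> (rep (iso_class C \<Omega>))"
proof -
  have "rep (iso_class C \<Omega>) \<in> iso_class C \<Omega>"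
    unfolding rep_def using iso_class_nonempty[OF assms] by (simp add: some_in_eq)
  then show "is_cset C (rep (iso_class C \<Omega>))" "cset_iso C \<Omega> (rep (iso_class C \<Omega>))"
    by (auto simp: iso_class_def)
qed

lemma iso_class_cong:
  assumes "is_cset C \<Omega>" "is_cset C \<Psi>" "cset_iso C \<Omega> \<Psi>"
  shows "iso_class C \<Omega> = iso_class C \<Psi>"
  using assms cset_iso_trans cset_iso_sym unfolding iso_class_def by (metis (no_types, lifting))

lemma simple_rep_iso_class: "simple C \<Phi> \<Longrightarrow> simple C (rep (iso_class C \<Phi>))"
  using simple_cong rep_iso_class simple_is_cset by blast

text \<open>\<open>simple_classes\<close> ranges over C-sets of naturals, while \<Phi> may have
  another element type, such as pairs inside a product. The representative over \<open>nat\<close>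
  bridges the two.\<close>

lemma iso_class_in_simple_classes:
  assumes "simple C \<Phi>"
  shows "iso_class C \<Phi> \<in> simple_classes C"
proof -
  have "iso_class C \<Phi> = iso_class C (rep (iso_class C \<Phi>))"
    using iso_class_cong rep_iso_class simple_is_cset[OF assms] by blast
  then show ?thesis
    using simple_rep_iso_class[OF assms] by (auto simp: simple_classes_def)
qed

lemma simple_rep: "c \<in> simple_classes C \<Longrightarrow> simple C (rep c)"
  using simple_rep_iso_class by (auto simp: simple_classes_def)

lemma iso_class_rep:
  assumes "c \<in> simple_classes C"
  shows "iso_class C (rep c) = c"
proof -
  obtain S :: "('o, 'm, nat) cset" where S: "simple C S" "c = iso_class C S"
    using assms by (auto simp: simple_classes_def)
  then show ?thesis
    using iso_class_cong[OF _ rep_iso_class] simple_is_cset[OF S(1)] by metis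
qed

section \<open>Finiteness of the set of simple classes\<close>

text \<open>The orbit of one element \<open>a\<close> under all morphisms out of its object is
  closed and non-empty, hence is all of \<open>S\<close>. So each element has the form
  \<open>act S f a\<close> for some morphism \<open>f\<close>.\<close>

lemma card_obj_simple_le:
  assumes S: "simple C S" and x: "x \<in> Obj C"
  shows "card (obj S x) \<le> card (Mor C)"
proof -
  note cS = simple_is_cset[OF S]
  obtain y a where y: "y \<in> Obj C" and a: "a \<in> obj S y"
    using simple_nonempty[OF S] by blast
  let ?A = "\<lambda>z. {act S f a |f. f \<in> Mor C \<and> Dom C f = y \<and> Cod C f = z}"
  have "closed_family C S ?A"
    unfolding closed_family_def
  proof (intro conjI ballI)
    fix f b assume f: "f \<in> Mor C" and "b \<in> ?A (Dom C f)"
    then obtain g where g: "g \<in> Mor C" "Dom C g = y" "Cod C g = Dom C f" "b = act S g a"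
      by blast
    then have "act S f b = act S (Cmp C f g) a"
      using f a by (simp add: cset_act_Cmp[OF cS])
    then show "act S f b \<in> ?A (Cod C f)"
      using f g Cmp_in Dom_Cmp Cod_Cmp by blast
  qed (use cset_act_in[OF cS] a in blast)
  \<comment> \<open>The identity keeps the orbit non-empty.\<close>
  moreover have "act S (Ide C y) a \<in> ?A y"
    using y Ide_in Dom_Ide Cod_Ide by blast
  ultimately have "obj S x = ?A x"
    using simple_closed_family[OF S _ y _ x] by blast
  then have "obj S x \<subseteq> (\<lambda>f. act S f a) ` Mor C" by auto
  then show ?thesis by (rule surj_card_le[OF finite_Mor])
qed

text \<open>By the orbit bound every class has a member with values inside one fixed finite set of
  naturals, and extensionality leaves only finitely many such records.\<close>

lemma finite_simple_classes: "finite (simple_classes C)"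
proof (rule finite_subset)
  let ?N = "card (Mor C)"
  let ?B = "{\<Psi> :: ('o, 'm, nat) cset. is_cset C \<Psi> \<and> (\<forall>x\<in>Obj C. obj \<Psi> x \<subseteq> {..<?N})}"
  let ?O = "\<Pi>\<^sub>E x\<in>Obj C. Pow {..<?N}"
  show "simple_classes C \<subseteq> iso_class C ` ?B"
  proof
    fix c assume "c \<in> simple_classes C"
    then obtain S :: "('o, 'm, nat) cset" where S: "simple C S" "c = iso_class C S"
      by (auto simp: simple_classes_def)
    then obtain \<Psi> :: "('o, 'm, nat) cset" where "is_cset C \<Psi>" "cset_iso C S \<Psi>"
      "\<And>x. x \<in> Obj C \<Longrightarrow> obj \<Psi> x \<subseteq> {..<?N}"
      using ex_nat_cset_iso[OF simple_is_cset[OF S(1)] card_obj_simple_le[OF S(1)]] by metis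
    then show "c \<in> iso_class C ` ?B"
      using S iso_class_cong simple_is_cset by blast
  qed
  \<comment> \<open>The space of possible actions depends on the chosen family \<open>u\<close>,
    hence a union over \<open>u\<close> and not a plain product.\<close>
  have "?B \<subseteq> (\<Union>u\<in>?O. (\<lambda>a. \<lparr>obj = u, act = a\<rparr>) ` (\<Pi>\<^sub>E f\<in>Mor C. u (Dom C f) \<rightarrow>\<^sub>E u (Cod C f)))"
  proof
    fix \<Psi> assume \<Psi>: "\<Psi> \<in> ?B"
    then have "obj \<Psi> \<in> ?O"
      unfolding is_cset_def PiE_iff by blast
    moreover have "act \<Psi> \<in> (\<Pi>\<^sub>E f\<in>Mor C. obj \<Psi> (Dom C f) \<rightarrow>\<^sub>E obj \<Psi> (Cod C f))"
      using \<Psi> unfolding is_cset_def by blast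
    moreover have "\<Psi> = \<lparr>obj = obj \<Psi>, act = act \<Psi>\<rparr>" by simp
    ultimately show "\<Psi> \<in> (\<Union>u\<in>?O. (\<lambda>a. \<lparr>obj = u, act = a\<rparr>) `
        (\<Pi>\<^sub>E f\<in>Mor C. u (Dom C f) \<rightarrow>\<^sub>E u (Cod C f)))"
      by blast
  qed
  moreover have "finite (\<Union>u\<in>?O. (\<lambda>a. \<lparr>obj = u, act = a\<rparr>) `
      (\<Pi>\<^sub>E f\<in>Mor C. u (Dom C f) \<rightarrow>\<^sub>E u (Cod C f)))"
  proof (intro finite_UN_I finite_imageI finite_PiE finite_Obj finite_Mor)
    fix u f assume "u \<in> ?O" "f \<in> Mor C"
    then have "u (Dom C f) \<subseteq> {..<?N}" "u (Cod C f) \<subseteq> {..<?N}"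
      using Dom_in Cod_in by (meson PiE_mem PowD)+
    then show "finite (u (Dom C f))" "finite (u (Cod C f))"
      by (auto intro: finite_subset)
  qed auto
  ultimately show "finite (iso_class C ` ?B)"
    by (intro finite_imageI) (rule finite_subset)
qed

text \<open>Such a morphism is surjective at every object; the size condition leaves no room for a
  collapse, so it is bijective everywhere.\<close>

lemma simple_Hom_imp_iso:
  assumes S: "simple C S" and T: "simple C T" and \<eta>: "\<eta> \<in> Hom C S T"
    and le: "cset_size C S \<le> cset_size C T"
  shows "cset_iso C S T"
proof -
  note surj = simple_Hom_surj[OF S T \<eta>]
  have fin: "finite (obj S x)" if "x \<in> Obj C" for x
    using cset_finite[OF simple_is_cset[OF S] that] .
  have cle: "card (obj T x) \<le> card (obj S x)" if "x \<in> Obj C" for x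
    using surj[OF that] card_image_le[OF fin[OF that], of "\<eta> x"] by simp
  \<comment> \<open>Each summand for \<open>T\<close> is at most the one for \<open>S\<close>, while
    the totals compare the other way, so all summands agree.\<close>
  have "card (obj T x) = card (obj S x)" if "x \<in> Obj C" for x
    using sum_mono_inv[of "\<lambda>x. card (obj T x)" "Obj C" "\<lambda>x. card (obj S x)", OF _ cle that finite_Obj] le
      sum_mono[of "Obj C" "\<lambda>x. card (obj T x)" "\<lambda>x. card (obj S x)", OF cle]
    unfolding cset_size_def by simp
  then have inj: "inj_on (\<eta> x) (obj S x)" if "x \<in> Obj C" for x
    using that surj fin by (simp add: inj_on_iff_eq_card)
  note tr = cset_iso_transport[OF simple_is_cset[OF S], of \<eta>, OF inj]
  \<comment> \<open>Identifying \<open>T\<close> with the transport of \<open>S\<close> along \<eta>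
    yields the inverse morphism from \<open>cset_iso_transport\<close>.\<close>
  have "transport_cset C S \<eta> = T"
  proof (rule cset_eqI)
    fix f b assume f: "f \<in> Mor C" and "b \<in> obj (transport_cset C S \<eta>) (Dom C f)"
    then obtain a where "a \<in> obj S (Dom C f)" "b = \<eta> (Dom C f) a"
      by (auto simp: transport_cset_def Dom_in)
    then show "act (transport_cset C S \<eta>) f b = act T f b"
      using f inj by (simp add: transport_cset_def Dom_in Hom_act[OF \<eta>])
  qed (use tr surj simple_is_cset[OF T] in \<open>auto simp: transport_cset_def\<close>)
  then show ?thesis using tr(2) by simp
qed

section \<open>Marks\<close>

text \<open>Terms outside the support vanish. A common index set is what allows marks of different
  elements to be compared termwise.\<close>

lemma mark_superset:
  assumes "finite A" "Poly_Mapping.keys u \<subseteq> A"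
  shows "mark C S u = (\<Sum>t\<in>A. Poly_Mapping.lookup u t * int (card (Hom C S (rep t))))"
  unfolding mark_def using assms by (intro sum.mono_neutral_left) (auto simp: in_keys_iff)

lemma mark_0 [simp]: "mark C S 0 = 0"
  by (simp add: mark_def)

lemma mark_add: "mark C S (u + v) = mark C S u + mark C S v"
proof -
  let ?A = "Poly_Mapping.keys u \<union> Poly_Mapping.keys v"
  have "mark C S w = (\<Sum>t\<in>?A. Poly_Mapping.lookup w t * int (card (Hom C S (rep t))))"
    if "w \<in> {u, v, u + v}" for w
    using that keys_add[of u v] by (intro mark_superset) auto
  then show ?thesis
    by (simp add: lookup_add distrib_right sum.distrib)
qed

lemma mark_cmul: "mark C S (frag_cmul k u) = k * mark C S u"
  using mark_superset[OF finite_keys keys_cmul, of S k u]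
  by (simp add: mark_def sum_distrib_left mult.assoc)

lemma mark_diff: "mark C S (u - v) = mark C S u - mark C S v"
  using mark_add[of S "u - v" v] by simp

lemma mark_sum: "mark C S (sum f A) = (\<Sum>i\<in>A. mark C S (f i))"
  by (induction A rule: infinite_finite_induct) (auto simp: mark_add)

lemma mark_frag_of: "mark C S (frag_of c) = int (card (Hom C S (rep c)))"
  by (simp add: mark_def)

section \<open>Marks as counts of morphisms, and their multiplicativity\<close>

text \<open>Summing over simple sub-C-sets recovers all morphisms by \<open>card_Hom_simple\<close>,
  and replacing each summand by its representative does not change the count.\<close>

lemma mark_burnside_class:
  assumes S: "simple C S" and \<Omega>: "is_cset C \<Omega>"
  shows "mark C S (burnside_class C \<Omega>) = int (card (Hom C S \<Omega>))"
proof -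
  have "card (Hom C S (rep (iso_class C \<Phi>))) = card (Hom C S \<Phi>)"
    if "\<Phi> \<in> simple_csubsets C \<Omega>" for \<Phi>
  proof -
    have "is_cset C \<Phi>" using that by (auto simp: simple_csubsets_def intro: simple_is_cset)
    then show ?thesis
      using card_Hom_cong[OF simple_is_cset[OF S]] rep_iso_class by metis
  qed
  then show ?thesis
    by (simp add: burnside_class_def mark_sum mark_frag_of card_Hom_simple[OF S \<Omega>])
qed

lemma burnside_class_soc:
  "is_cset C \<Omega> \<Longrightarrow> burnside_class C (soc C \<Omega>) = burnside_class C \<Omega>"
  by (simp add: burnside_class_def simple_csubsets_soc)

lemma keys_burnside_class: "Poly_Mapping.keys (burnside_class C \<Omega>) \<subseteq> simple_classes C"
proof -
  have "burnside_class C \<Omega> \<in> carrier (free_Abelian_group (simple_classes C))"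
    unfolding burnside_class_def
    by (intro sum_closed_free_Abelian_group)
      (simp add: simple_csubsets_def iso_class_in_simple_classes)
  then show ?thesis by simp
qed

lemma keys_burnside_mult: "Poly_Mapping.keys (burnside_mult C u v) \<subseteq> simple_classes C"
  unfolding burnside_mult_def using keys_burnside_class
  by (intro order_trans[OF keys_frag_extend] UN_least) blast

text \<open>On basis elements the socle is invisible and morphisms into a product are pairs of
  morphisms. Bilinearity does the rest; the support conditions ensure that the representatives are
  C-sets.\<close>

lemma mark_burnside_mult:
  assumes S: "simple C S"
    and u: "Poly_Mapping.keys u \<subseteq> simple_classes C" and v: "Poly_Mapping.keys v \<subseteq> simple_classes C"
  shows "mark C S (burnside_mult C u v) = mark C S u * mark C S v"
proof -
  have "mark C S (burnside_class C (soc C (prod_cset C (rep s) (rep t)))) =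
      int (card (Hom C S (rep s))) * int (card (Hom C S (rep t)))"
    if "s \<in> Poly_Mapping.keys u" "t \<in> Poly_Mapping.keys v" for s t
  proof -
    have "is_cset C (prod_cset C (rep s) (rep t))"
      using that u v by (intro is_cset_prod simple_is_cset simple_rep) auto
    then show ?thesis
      using S by (simp add: burnside_class_soc mark_burnside_class card_Hom_prod simple_is_cset)
  qed
  then have "mark C S (burnside_mult C u v) =
      (\<Sum>s\<in>Poly_Mapping.keys u. \<Sum>t\<in>Poly_Mapping.keys v.
        (Poly_Mapping.lookup u s * int (card (Hom C S (rep s)))) *
        (Poly_Mapping.lookup v t * int (card (Hom C S (rep t)))))"
    by (simp add: burnside_mult_def frag_extend_def mark_sum mark_cmul sum_distrib_left mult_ac)
  then show ?thesis
    by (simp only: mark_def[of C S u] mark_def[of C S v] sum_product)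
qed

lemma mark_one: "simple C S \<Longrightarrow> mark C S (burnside_class C (soc C (one_cset C))) = 1"
  by (simp add: burnside_class_soc is_cset_one mark_burnside_class card_Hom_one simple_is_cset)

text \<open>
  The table of marks is triangular: for \<open>t\<close> of minimal size in the support of \<open>u\<close>, every other
  \<open>t'\<close> in the support has \<open>Hom (rep t) (rep t') = {}\<close>, as such a morphism is surjective.
\<close>

lemma mark_eq_0_imp_eq_0:
  assumes u: "Poly_Mapping.keys u \<subseteq> simple_classes C"
    and 0: "\<And>t. t \<in> simple_classes C \<Longrightarrow> mark C (rep t) u = 0"
  shows "u = 0"
proof (rule ccontr)
  assume "u \<noteq> 0"
  then have "Poly_Mapping.keys u \<noteq> {}" by simp
  then obtain t where t: "t \<in> Poly_Mapping.keys u"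
    and min: "\<And>t'. t' \<in> Poly_Mapping.keys u \<Longrightarrow> cset_size C (rep t) \<le> cset_size C (rep t')"
    using ex_min_if_finite[of "(\<lambda>t. cset_size C (rep t)) ` Poly_Mapping.keys u"]
    by (fastforce simp: not_less)
  have tC: "t \<in> simple_classes C" using t u by blast
  \<comment> \<open>By minimality of \<open>t\<close> a morphism would be an isomorphism, and then
    the two classes would coincide.\<close>
  have "Hom C (rep t) (rep t') = {}" if "t' \<in> Poly_Mapping.keys u" "t' \<noteq> t" for t'
  proof (rule ccontr)
    assume "Hom C (rep t) (rep t') \<noteq> {}"
    moreover have t'C: "t' \<in> simple_classes C" using that u by blast
    ultimately have "cset_iso C (rep t) (rep t')"
      using tC min[OF that(1)] simple_Hom_imp_iso simple_rep by blast
    then have "iso_class C (rep t) = iso_class C (rep t')"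
      using tC t'C by (intro iso_class_cong simple_is_cset simple_rep)
    then show False using tC t'C that by (simp add: iso_class_rep)
  qed
  then have "mark C (rep t) u = Poly_Mapping.lookup u t * int (card (Hom C (rep t) (rep t)))"
    using t by (auto simp: mark_def sum.remove[OF finite_keys t])
  moreover have cs: "is_cset C (rep t)" using tC by (intro simple_is_cset simple_rep)
  \<comment> \<open>The diagonal entry counts at least the identity.\<close>
  then have "card (Hom C (rep t) (rep t)) \<noteq> 0"
    using finite_Hom[OF cs cs] id_nat_in_Hom[OF cs] by auto
  ultimately show False
    using 0[OF tC] t by (simp add: in_keys_iff)
qed

end

section \<open>Prime ideals\<close>

text \<open>A non-zero ideal is generated by its least positive element \<open>n\<close>, and
  primality of the ideal makes \<open>n\<close> prime. The closure conditions are spelled out so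
  that they can be checked directly on the image of an ideal under a mark.\<close>

lemma int_prime_ideal_cases:
  fixes J :: "int set"
  assumes zero: "0 \<in> J" and diff: "\<And>a b. a \<in> J \<Longrightarrow> b \<in> J \<Longrightarrow> a - b \<in> J"
    and mult: "\<And>a k. a \<in> J \<Longrightarrow> k * a \<in> J"
    and one: "1 \<notin> J" and pr: "\<And>a b. a * b \<in> J \<Longrightarrow> a \<in> J \<or> b \<in> J"
  obtains "J = {0}" | p :: nat where "prime p" "J = {k. int p dvd k}"
proof (cases "J = {0}")
  case False
  then obtain a where a: "a \<in> J" "a \<noteq> 0" using zero by blast
  define n where "n = (LEAST n. 0 < n \<and> int n \<in> J)"
  have "0 < nat \<bar>a\<bar> \<and> int (nat \<bar>a\<bar>) \<in> J"
    using a mult[OF a(1), of "-1"] by (simp add: abs_if)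
  then have n: "0 < n" "int n \<in> J"
    unfolding n_def by (metis (mono_tags, lifting) LeastI)+
  have "int n dvd k" if k: "k \<in> J" for k
  proof -
    \<comment> \<open>Division with remainder: the remainder lies in \<open>J\<close> and is smaller
      than \<open>n\<close>, so it is zero.\<close>
    have "k - (k div int n) * int n \<in> J"
      by (rule diff[OF k mult[OF n(2)]])
    then have "int (nat (k mod int n)) \<in> J"
      using n by (simp add: minus_div_mult_eq_mod)
    moreover have "nat (k mod int n) < n"
      using n by (simp add: nat_less_iff)
    ultimately have "nat (k mod int n) = 0"
      using not_less_Least[of "nat (k mod int n)" "\<lambda>n. 0 < n \<and> int n \<in> J"] by (auto simp: n_def)
    moreover have "k mod int n \<ge> 0" using n by simp
    ultimately show ?thesis by (simp add: dvd_eq_mod_eq_0)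
  qed
  then have J: "J = {k. int n dvd k}"
    using mult[OF n(2)] by (auto elim!: dvdE simp: mult.commute)
  have "prime (int n)"
    unfolding prime_def prime_elem_def using n one pr J by auto
  then show ?thesis using J that(2) by simp
qed (rule that(1))

context finite_category
begin

section \<open>The simple Burnside ring as a commutative ring\<close>

abbreviation "B \<equiv> simple_burnside_ring C"

lemma carrier_burnside [simp]: "u \<in> carrier B \<longleftrightarrow> Poly_Mapping.keys u \<subseteq> simple_classes C"
  by (simp add: simple_burnside_ring_def)

lemma burnside_ring_simps [simp]:
  "u \<otimes>\<^bsub>B\<^esub> v = burnside_mult C u v" "u \<oplus>\<^bsub>B\<^esub> v = u + v" "\<zero>\<^bsub>B\<^esub> = 0"
  "\<one>\<^bsub>B\<^esub> = burnside_class C (soc C (one_cset C))"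
  by (simp_all add: simple_burnside_ring_def)

text \<open>Joint injectivity of the marks, applied to the difference, reduces identities in the
  ring to identities between integers.\<close>

lemma burnside_eqI:
  assumes u: "u \<in> carrier B" and v: "v \<in> carrier B"
    and eq: "\<And>S :: ('o, 'm, nat) cset. simple C S \<Longrightarrow> mark C S u = mark C S v"
  shows "u = v"
proof -
  have "u - v = 0"
  proof (rule mark_eq_0_imp_eq_0)
    show "Poly_Mapping.keys (u - v) \<subseteq> simple_classes C"
      using u v keys_diff[of u v] by auto
    show "mark C (rep t) (u - v) = 0" if "t \<in> simple_classes C" for t
      using eq[OF simple_rep[OF that]] by (simp add: mark_diff)
  qed
  then show ?thesis by simp
qed

lemma keys_add_subset:
  "Poly_Mapping.keys u \<subseteq> A \<Longrightarrow> Poly_Mapping.keys v \<subseteq> A \<Longrightarrow> Poly_Mapping.keys (u + v) \<subseteq> A"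
  using keys_add[of u v] by blast

text \<open>The ring axioms hold because they hold for all marks and the marks separate points.\<close>

lemma cring_burnside: "cring B"
proof (rule cringI)
  show "abelian_group B"
  proof (rule abelian_groupI)
    show "\<exists>y\<in>carrier B. y \<oplus>\<^bsub>B\<^esub> x = \<zero>\<^bsub>B\<^esub>" if "x \<in> carrier B" for x
      using that by (intro bexI[of _ "- x"]) auto
  qed (auto simp: keys_add_subset)
  show "comm_monoid B"
    by (rule comm_monoidI)
      (auto intro!: burnside_eqI
        simp: keys_burnside_mult keys_burnside_class mark_burnside_mult mark_one mult_ac)
  show "(x \<oplus>\<^bsub>B\<^esub> y) \<otimes>\<^bsub>B\<^esub> z = x \<otimes>\<^bsub>B\<^esub> z \<oplus>\<^bsub>B\<^esub> y \<otimes>\<^bsub>B\<^esub> z"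
    if "x \<in> carrier B" "y \<in> carrier B" "z \<in> carrier B" for x y z
    using that by (intro burnside_eqI)
      (auto simp: keys_burnside_mult keys_add_subset mark_burnside_mult mark_add distrib_right)
qed

text \<open>This links subtraction in the ring record with subtraction of finitely supported
  functions, for which \<open>mark_diff\<close> is available.\<close>

lemma burnside_minus:
  assumes u: "u \<in> carrier B" and v: "v \<in> carrier B"
  shows "u \<ominus>\<^bsub>B\<^esub> v = u - v"
proof -
  interpret cring B by (rule cring_burnside)
  have "\<ominus>\<^bsub>B\<^esub> v = - v"
    using v by (intro minus_equality) auto
  then show ?thesis by (simp add: a_minus_def)
qed

section \<open>The ideals attached to marks\<close>

lemma mark_ring_hom_ring:
  assumes "simple C S"
  shows "ring_hom_ring B \<Z> (mark C S)"
  by (rule ring_hom_ringI)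
    (use assms in \<open>auto simp: cring.axioms(1)[OF cring_burnside] cring.axioms(1)[OF int_is_cring]
      mark_burnside_mult mark_add mark_one\<close>)

text \<open>Writing the kernel as the preimage of the zero ideal gives it the shape expected by
  \<open>primeideal_vimage\<close>.\<close>

lemma mark_ideal_eq: "mark_ideal C S = {u \<in> carrier B. mark C S u \<in> {\<zero>\<^bsub>\<Z>\<^esub>}}"
  by (simp add: mark_ideal_def a_kernel_def kernel_def)

text \<open>A coset of an ideal is the zero of the quotient exactly when its representative lies in
  the ideal, so this kernel is also the preimage of an ideal of the integers.\<close>

lemma mark_ideal_mod_eq:
  "mark_ideal_mod C S p = {u \<in> carrier B. mark C S u \<in> Idl\<^bsub>\<Z>\<^esub> {int p}}"
proof -
  let ?I = "Idl\<^bsub>\<Z>\<^esub> {int p}"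
  have "?I +>\<^bsub>\<Z>\<^esub> k = ?I \<longleftrightarrow> k \<in> ?I" for k
  proof -
    interpret I: ideal ?I \<Z> by (rule int.genideal_ideal) simp
    show ?thesis
      using I.a_rcos_self[of k] I.a_rcos_const[of k] by auto
  qed
  then show ?thesis
    by (simp add: mark_ideal_mod_def a_kernel_def kernel_def ZFact_def FactRing_def)
qed

lemma mem_int_Idl: "k \<in> Idl\<^bsub>\<Z>\<^esub> {a} \<longleftrightarrow> a dvd k"
  by (auto simp: int_Idl dvd_def mult.commute)

text \<open>The zero ideal of the integers is prime, and preimages of primes under a homomorphism of
  commutative rings are prime.\<close>

lemma mark_ideal_primeideal: "simple C S \<Longrightarrow> primeideal (mark_ideal C S) B"
  unfolding mark_ideal_eq
  by (rule ring_hom_ring.primeideal_vimage[OF mark_ring_hom_ring cring_burnside])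
    (use int.zeroprimeideal in simp_all)

lemma mark_ideal_mod_primeideal:
  "simple C S \<Longrightarrow> prime p \<Longrightarrow> primeideal (mark_ideal_mod C S p) B"
  unfolding mark_ideal_mod_eq
  by (rule ring_hom_ring.primeideal_vimage[OF mark_ring_hom_ring cring_burnside prime_primeideal])
    simp_all

section \<open>Classification of the prime ideals\<close>

text \<open>If no kernel were contained in \<open>P\<close>, one could pick from each of the
  finitely many kernels an element outside \<open>P\<close>. Their product lies outside the prime
  \<open>P\<close> but has all marks zero, so it is 0, which is in \<open>P\<close>.\<close>

lemma primeideal_mark_ideal_subset:
  assumes "primeideal P B"
  obtains S :: "('o, 'm, nat) cset" where "simple C S" "mark_ideal C S \<subseteq> P"
proof (rule ccontr)
  interpret P: primeideal P B by fact
  assume "\<not> thesis"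
  then have "\<not> mark_ideal C (rep t) \<subseteq> P" if "t \<in> simple_classes C" for t
    using \<open>\<And>S. simple C S \<Longrightarrow> mark_ideal C S \<subseteq> P \<Longrightarrow> thesis\<close> simple_rep[OF that] by blast
  then have "\<exists>w\<in>carrier B. mark C (rep t) w = 0 \<and> w \<notin> P" if "t \<in> simple_classes C" for t
    using that unfolding mark_ideal_eq by fastforce
  then obtain w where w: "\<And>t. t \<in> simple_classes C \<Longrightarrow>
      w t \<in> carrier B \<and> mark C (rep t) (w t) = 0 \<and> w t \<notin> P"
    by metis
  \<comment> \<open>The witness is the product of the \<open>w t\<close> for \<open>t\<close> in
    \<open>A\<close>, built one factor at a time from the ring unit, which is outside the proper
    ideal \<open>P\<close>.\<close>
  have "\<exists>v\<in>carrier B. v \<notin> P \<and> (\<forall>t\<in>A. mark C (rep t) v = 0)" if "A \<subseteq> simple_classes C" for A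
    using finite_subset[OF that finite_simple_classes] that
  proof (induction A rule: finite_induct)
    case empty
    then show ?case
      using P.one_closed P.one_imp_carrier P.I_notcarr by blast
  next
    case (insert t A)
    then obtain v where v: "v \<in> carrier B" "v \<notin> P" "\<forall>t\<in>A. mark C (rep t) v = 0" by blast
    have t: "t \<in> simple_classes C" using insert.prems by blast
    have "w t \<otimes>\<^bsub>B\<^esub> v \<notin> P" using P.I_prime w[OF t] v by blast
    moreover have "mark C (rep s) (w t \<otimes>\<^bsub>B\<^esub> v) = 0" if "s \<in> insert t A" for s
    proof -
      have "s \<in> simple_classes C" using that insert.prems by blast
      then show ?thesis
        using that w[OF t] v by (auto simp: mark_burnside_mult simple_rep)
    qed
    ultimately show ?case
      using P.m_closed w[OF t] v(1) by blast
  qed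
  from this[OF subset_refl] obtain v
    where "v \<in> carrier B" "v \<notin> P" "\<forall>t\<in>simple_classes C. mark C (rep t) v = 0"
    by blast
  then show False
    using mark_eq_0_imp_eq_0[of v] additive_subgroup.zero_closed[OF P.is_additive_subgroup] by simp
qed

text \<open>As \<open>P\<close> contains the kernel of a mark, it is the full preimage of its image
  \<open>?J\<close>. The mark is onto the integers, so \<open>?J\<close> is a prime ideal there and
  must be zero or generated by a prime.\<close>

lemma primeideal_burnside_cases:
  assumes "primeideal P B"
  obtains S :: "('o, 'm, nat) cset" where "simple C S" "P = mark_ideal C S"
  | S :: "('o, 'm, nat) cset" and p :: nat
    where "simple C S" "prime p" "P = mark_ideal_mod C S p"
proof -
  interpret P: primeideal P B by fact
  obtain S :: "('o, 'm, nat) cset" where S: "simple C S" and sub: "mark_ideal C S \<subseteq> P"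
    using primeideal_mark_ideal_subset[OF assms] .
  interpret h: ring_hom_ring B \<Z> "mark C S" by (rule mark_ring_hom_ring[OF S])
  let ?J = "mark C S ` P"
  have P_carr: "u \<in> carrier B" if "u \<in> P" for u using P.Icarr[OF that] .
  \<comment> \<open>Two elements with equal marks differ by an element of the kernel, which lies in
    \<open>P\<close>.\<close>
  have P_iff: "u \<in> P \<longleftrightarrow> mark C S u \<in> ?J" if u: "u \<in> carrier B" for u
  proof
    assume "mark C S u \<in> ?J"
    then obtain v where v: "v \<in> P" "mark C S u = mark C S v" by blast
    have "u - v \<in> carrier B"
      using P.minus_closed[OF u P_carr[OF v(1)]] burnside_minus[OF u P_carr[OF v(1)]] by simp
    then have "u - v \<in> mark_ideal C S"
      using v by (simp add: mark_ideal_eq mark_diff)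
    then have "(u - v) \<oplus>\<^bsub>B\<^esub> v \<in> P"
      using sub v additive_subgroup.a_closed[OF P.is_additive_subgroup] by blast
    then show "u \<in> P" by simp
  qed blast
  \<comment> \<open>The \<open>k\<close>-fold multiple of the ring unit has mark
    \<open>k\<close>.\<close>
  have surj: "\<exists>u\<in>carrier B. mark C S u = k" for k
    by (intro bexI[of _ "frag_cmul k \<one>\<^bsub>B\<^esub>"])
      (use keys_burnside_class in \<open>auto simp: mark_cmul mark_one[OF S]\<close>)
  have P_eq: "P = {u \<in> carrier B. mark C S u \<in> X}" if "?J = X" for X
    using P_iff P_carr that by blast
  show thesis
  proof (rule int_prime_ideal_cases[of ?J])
    have "0 \<in> P" using additive_subgroup.zero_closed[OF P.is_additive_subgroup] by simp
    then show "0 \<in> ?J" using mark_0 by (metis imageI)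
    show "a - b \<in> ?J" if "a \<in> ?J" "b \<in> ?J" for a b
    proof -
      obtain u v where uv: "u \<in> P" "v \<in> P" "a = mark C S u" "b = mark C S v"
        using \<open>a \<in> ?J\<close> \<open>b \<in> ?J\<close> by blast
      have "u \<ominus>\<^bsub>B\<^esub> v \<in> P"
        using uv additive_subgroup.a_closed[OF P.is_additive_subgroup]
          additive_subgroup.a_inv_closed[OF P.is_additive_subgroup]
        unfolding a_minus_def by blast
      then have "u - v \<in> P" using uv P_carr burnside_minus by metis
      then show ?thesis using uv mark_diff by (metis imageI)
    qed
    show "k * a \<in> ?J" if "a \<in> ?J" for a k
    proof -
      obtain u v where uv: "u \<in> P" "a = mark C S u" "v \<in> carrier B" "mark C S v = k"
        using \<open>a \<in> ?J\<close> surj by blast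
      then have "v \<otimes>\<^bsub>B\<^esub> u \<in> P" by (intro P.I_l_closed)
      moreover have "mark C S (v \<otimes>\<^bsub>B\<^esub> u) = k * a"
        using uv P_carr[OF uv(1)] by (simp add: mark_burnside_mult[OF S])
      ultimately show ?thesis by (metis imageI)
    qed
    \<comment> \<open>The ring unit has mark 1, so \<open>P_iff\<close> would put it into the proper
      ideal \<open>P\<close>.\<close>
    show "1 \<notin> ?J"
      using P_iff[OF P.one_closed] P.one_imp_carrier P.I_notcarr mark_one[OF S] by auto
    \<comment> \<open>Lift both factors to the ring; by \<open>P_iff\<close> the product of the
      lifts is in \<open>P\<close>, and primality of \<open>P\<close> applies.\<close>
    show "a \<in> ?J \<or> b \<in> ?J" if "a * b \<in> ?J" for a b
    proof -
      obtain u v where uv: "u \<in> carrier B" "mark C S u = a" "v \<in> carrier B" "mark C S v = b"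
        using surj by metis
      then have "mark C S (u \<otimes>\<^bsub>B\<^esub> v) \<in> ?J"
        using \<open>a * b \<in> ?J\<close> by (simp add: mark_burnside_mult[OF S])
      then have "u \<otimes>\<^bsub>B\<^esub> v \<in> P" using P_iff P.m_closed uv by blast
      then show ?thesis using P.I_prime uv by blast
    qed
  next
    assume "?J = {0}"
    then have "P = mark_ideal C S"
      unfolding mark_ideal_eq int_zero_eq by (rule P_eq)
    then show thesis using that(1) S by blast
  next
    fix p :: nat assume "prime p" "?J = {k. int p dvd k}"
    then have "?J = Idl\<^bsub>\<Z>\<^esub> {int p}" using mem_int_Idl by blast
    then have "P = mark_ideal_mod C S p"
      unfolding mark_ideal_mod_eq by (rule P_eq)
    then show thesis using that(2) S \<open>prime p\<close> by blast
  qed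
qed

end

theorem theorem5p3:
  fixes C :: "('o, 'm) cat"
  assumes "finite_category C" and "connected_category C"
  shows "Spec (simple_burnside_ring C) =
    {mark_ideal C S |S :: ('o, 'm, nat) cset. simple C S} \<union>
    {mark_ideal_mod C S p |(S :: ('o, 'm, nat) cset) p. simple C S \<and> prime p}"
proof -
  interpret finite_category C by fact
  show ?thesis
    unfolding Spec_def
    using mark_ideal_primeideal mark_ideal_mod_primeideal
    by (auto elim: primeideal_burnside_cases)
qed

end
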